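(* Let $n\ge2$ be an integer and let $L,\mu,R,\varepsilon>0$. Assume $\kappa=L/\mu\ge2$ and $\varepsilon\le LR^2/4$. Then $$\mathfrak m_*^{\mathrm C}(\varepsilon,R,L,\mu)=\begin{cases}\Omega\big((n+\sqrt{\kappa n})\log(1/\varepsilon)\big), & \kappa=\Omega(n),\\ \Omega\left(n+\left(\dfrac{n}{1+(\log(n/\kappa))_+}\right)\log(1/\varepsilon)\right), & \kappa=O(n),\end{cases}$$ where $a_+=\max\{a,0\}$.
   Context: Norms are Euclidean. $\mathcal P_{\mathcal X}$ is Euclidean projection onto a closed convex set $\mathcal X$. Problem: $\min_{x\in\mathcal X}f(x)=\frac1n\sum_{i=1}^nf_i(x)$ with $\mathcal X\subseteq\mathbb R^d$ closed and convex. A differentiable function is $L$-smooth if its gradient is $L$-Lipschitz. $f$ is $\mu$-strongly convex if $f-\frac\mu2\|\cdot\|^2$ is convex (for $\mu=0$: $f$ convex). PIFO algorithms. Fix an absolute constant $c_0>0$ (e.g. $c_0=2$). The oracle $h^{\mathrm{PIFO}}_{f_i}(x,\gamma)$, $\gamma>0$, returns $[f_i(x),\nabla f_i(x),\mathrm{prox}^\gamma_{f_i}(x)]$ with $\mathrm{prox}^\gamma_{f_i}(x)=\arg\min_{u\in\mathbb R^d}\{f_i(u)+\frac1{2\gamma}\|x-u\|^2\}$ (when $f_i$ is nonconvex, $\gamma$ must be such that the minimized function is convex in $u$). The oracle $h^{\mathrm{FO}}_f(x)$ returns $[f(x),\nabla f(x)]$. A PIFO algorithm $\mathcal A$ fixes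 a distribution $\mathcal D$ on $\{1,\dots,n\}$ and $0<q\le c_0/n$, starts at $x_0=0$ with $\mathcal H=\{x_0\}$, and at step $t=1,2,\dots$: (i) samples $i_t\sim\mathcal D$ and queries $h^{\mathrm{PIFO}}_{f_{i_t}}$; (ii) samples $a_t\sim\mathrm{Bernoulli}(q)$ and, if $a_t=1$, queries $h^{\mathrm{FO}}_f$ and adds $x_{t-1}$ to $\mathcal H$; (iii) chooses $\tilde x_t$ in the linear span of $x_0,\dots,x_{t-1}$, of $\mathrm{prox}^{\gamma_j}_{f_{i_j}}(x_l)$ and $\nabla f_{i_j}(x_l)$ for $l<j\le t$, and of $\nabla f(u)$ for $u\in\mathcal H$; (iv) sets $x_t=\mathcal P_{\mathcal X}(\tilde x_t)$; (v) outputs $x_t$ or continues with $t+1$. The pairs $(i_t,a_t)$, $t\ge1$, are mutually independent and $i_t$ is independent of $a_t$. $\mathscr A$ is the class of all PIFO algorithms. Complexity. $\mathcal F^*_{\mathrm C}(R,L,\mu)$ is the set of $f=\frac1n\sum_{i=1}^nf_i:\mathcal X\to\mathbb R$ (any dimension $d$) with $\mathrm{diam}(\mathcal X)\le2R$, each $f_i$ $L$-smooth and $f$ $\mu$-strongly convex. $T(\mathcal A,f,\varepsilon)=\inf\{T\in\mathbb N:\mathbb Ef(x_{\mathcal A,T})-\min_{x\in\mathcal X}f(x)<\varepsilon\}$, where $x_{\mathcal A,T}$ is the point obtained by $\mathcal A$ at time-step $T$. $\mathfrak m^{\mathrm C}_*(\varepsilon,R,L,\mu)=\inf_{\mathcal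 A\in\mathscr A}\sup_{f\in\mathcal F^*_{\mathrm C}(R,L,\mu)}T(\mathcal A,f,\varepsilon)$. Asymptotic notation. $\Omega(g)$ means at least $c\,g$ with an absolute constant $c>0$ not depending on any problem parameter ($c_0$ being a fixed constant). A case condition $\kappa=\Omega(n)$ (resp. $O(n)$) means $\kappa\ge c'n$ (resp. $\kappa\le c'n$) for an absolute constant $c'$. In lower bounds, $\log(1/\varepsilon)$ is shorthand for $\log(s/\varepsilon)$ where the scale $s>0$ may depend on the other parameters but not on $\varepsilon$. *)

theory Defs
  imports "HOL-Probability.Probability"
begin

text \<open>
  The dimension is quantified inside the complexity measure, so it cannot be a type.  All spaces
  \<open>\<real>\<^sup>d\<close> are therefore realised inside one inner product space, that of the finitely
  supported real sequences: \<open>\<real>\<^sup>d\<close> is the subspace \<open>Rn d\<close> of the sequences that vanish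
  from index \<open>d\<close> on, with the Euclidean inner product, norm and topology.
\<close>

typedef finseq = "{x :: nat \<Rightarrow> real. finite {i. x i \<noteq> 0}}"
  morphisms coord Abs_finseq
  by (rule exI[of _ "\<lambda>_. 0"]) simp

lemma finite_coord [simp]: "finite {i. coord x i \<noteq> 0}"
  using coord[of x] by simp

lemma finseq_eqI: "(\<And>i. coord x i = coord y i) \<Longrightarrow> x = y"
  by (simp add: coord_inject[symmetric] fun_eq_iff)

lemma coord_Abs: "finite {i. f i \<noteq> 0} \<Longrightarrow> coord (Abs_finseq f) = f"
  by (simp add: Abs_finseq_inverse)

instantiation finseq :: real_vector
begin

definition "0 = Abs_finseq (\<lambda>_. 0)"
definition "x + y = Abs_finseq (\<lambda>i. coord x i + coord y i)"
definition "- x = Abs_finseq (\<lambda>i. - coord x i)"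
definition "x - y = Abs_finseq (\<lambda>i. coord x i - coord y i)"
definition "r *\<^sub>R x = Abs_finseq (\<lambda>i. r * coord x i)"

lemma coord_zero [simp]: "coord 0 i = 0"
  by (simp add: zero_finseq_def coord_Abs)

lemma coord_add [simp]: "coord (x + y) i = coord x i + coord y i"
proof -
  have "finite {i. coord x i + coord y i \<noteq> 0}"
    by (rule finite_subset[of _ "{i. coord x i \<noteq> 0} \<union> {i. coord y i \<noteq> 0}"]) auto
  then show ?thesis by (simp add: plus_finseq_def coord_Abs)
qed

lemma coord_minus [simp]: "coord (- x) i = - coord x i"
  by (simp add: uminus_finseq_def coord_Abs)

lemma coord_diff [simp]: "coord (x - y) i = coord x i - coord y i"
proof -
  have "finite {i. coord x i - coord y i \<noteq> 0}"
    by (rule finite_subset[of _ "{i. coord x i \<noteq> 0} \<union> {i. coord y i \<noteq> 0}"]) auto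
  then show ?thesis by (simp only: minus_finseq_def coord_Abs)
qed

lemma coord_scaleR [simp]: "coord (r *\<^sub>R x) i = r * coord x i"
proof -
  have "finite {i. r * coord x i \<noteq> 0}"
    by (rule finite_subset[of _ "{i. coord x i \<noteq> 0}"]) auto
  then show ?thesis by (simp only: scaleR_finseq_def coord_Abs)
qed

instance
  by standard (auto intro!: finseq_eqI simp: algebra_simps)

end

instantiation finseq :: real_inner
begin

definition "inner x y = (\<Sum>i | coord x i \<noteq> 0. coord x i * coord y i)"
definition "norm x = sqrt (inner x (x :: finseq))"
definition "sgn x = (x :: finseq) /\<^sub>R norm x"
definition "dist x y = norm (x - y :: finseq)"
definition "uniformity = (INF e\<in>{0<..}. principal {(x, y :: finseq). dist x y < e})"
definition "open U \<longleftrightarrow> (\<forall>x\<in>U. \<forall>\<^sub>F (x', y) in uniformity. x' = x \<longrightarrow> y \<in> (U :: finseq set))"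

lemma inner_finseq_superset:
  assumes "finite S" "{i. coord x i \<noteq> 0} \<subseteq> S"
  shows "inner x y = (\<Sum>i\<in>S. coord x i * coord y i)"
  unfolding inner_finseq_def by (rule sum.mono_neutral_left) (use assms in auto)

instance
proof
  fix x y z :: finseq and r :: real
  let ?S = "{i. coord x i \<noteq> 0} \<union> {i. coord y i \<noteq> 0}"
  have S: "finite ?S" by simp
  have ix: "inner x u = (\<Sum>i\<in>?S. coord x i * coord u i)" for u
    by (rule inner_finseq_superset) auto
  have iy: "inner y u = (\<Sum>i\<in>?S. coord y i * coord u i)" for u
    by (rule inner_finseq_superset) auto
  show "inner x y = inner y x"
    unfolding ix iy by (simp add: mult.commute)
  have "inner (x + y) z = (\<Sum>i\<in>?S. coord (x + y) i * coord z i)"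
    by (rule inner_finseq_superset) auto
  then show "inner (x + y) z = inner x z + inner y z"
    unfolding ix iy by (simp add: sum.distrib[symmetric] algebra_simps)
  have "inner (r *\<^sub>R x) y = (\<Sum>i\<in>?S. coord (r *\<^sub>R x) i * coord y i)"
    by (rule inner_finseq_superset) auto
  then show "inner (r *\<^sub>R x) y = r * inner x y"
    unfolding ix by (simp add: sum_distrib_left algebra_simps)
  show "0 \<le> inner x x"
    unfolding inner_finseq_def by (rule sum_nonneg) simp
  show "inner x x = 0 \<longleftrightarrow> x = 0"
  proof
    assume "inner x x = 0"
    then have "\<forall>i\<in>{i. coord x i \<noteq> 0}. coord x i * coord x i = 0"
      unfolding inner_finseq_def by (subst (asm) sum_nonneg_eq_0_iff) auto
    then show "x = 0" by (intro finseq_eqI) auto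
  qed (simp add: inner_finseq_def)
qed (simp_all add: norm_finseq_def sgn_finseq_def dist_finseq_def
       uniformity_finseq_def open_finseq_def)

end

definition Rn :: "nat \<Rightarrow> finseq set" where
  "Rn d = {x. \<forall>i\<ge>d. coord x i = 0}"


definition grad :: "nat \<Rightarrow> (finseq \<Rightarrow> real) \<Rightarrow> finseq \<Rightarrow> finseq" where
  "grad d g x = (THE v. v \<in> Rn d \<and> (g has_derivative (\<lambda>h. inner v h)) (at x within Rn d))"

definition smooth :: "nat \<Rightarrow> real \<Rightarrow> (finseq \<Rightarrow> real) \<Rightarrow> bool" where
  "smooth d L g \<longleftrightarrow> g differentiable_on Rn d \<and> L-lipschitz_on (Rn d) (grad d g)"

definition strongly_convex :: "nat \<Rightarrow> real \<Rightarrow> (finseq \<Rightarrow> real) \<Rightarrow> bool" where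
  "strongly_convex d \<mu> g \<longleftrightarrow> convex_on (Rn d) (\<lambda>x. g x - \<mu> / 2 * (norm x)\<^sup>2)"

definition proj :: "finseq set \<Rightarrow> finseq \<Rightarrow> finseq" where
  "proj X x = arg_min_on (dist x) X"

definition prox_objective :: "(finseq \<Rightarrow> real) \<Rightarrow> real \<Rightarrow> finseq \<Rightarrow> finseq \<Rightarrow> real" where
  "prox_objective g \<gamma> x u = g u + 1 / (2 * \<gamma>) * (norm (x - u))\<^sup>2"

text \<open>
  An inadmissible \<open>\<gamma>\<close> (objective not convex, or without a minimiser) is answered by \<open>0\<close>,
  which contributes nothing to a linear span.
\<close>

definition prox :: "nat \<Rightarrow> (finseq \<Rightarrow> real) \<Rightarrow> real \<Rightarrow> finseq \<Rightarrow> finseq" where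
  "prox d g \<gamma> x =
     (if convex_on (Rn d) (prox_objective g \<gamma> x)
         \<and> (\<exists>u. is_arg_min (prox_objective g \<gamma> x) (\<lambda>u. u \<in> Rn d) u)
      then arg_min_on (prox_objective g \<gamma> x) (Rn d) else 0)"


text \<open>Only the components with index in \<open>{1..n}\<close> and their values on \<open>Rn (pdim P)\<close> matter.\<close>

record problem =
  pdim :: nat
  feasible :: "finseq set"
  component :: "nat \<Rightarrow> finseq \<Rightarrow> real"

definition objective :: "nat \<Rightarrow> problem \<Rightarrow> finseq \<Rightarrow> real" where
  "objective n P x = 1 / real n * (\<Sum>i=1..n. component P i x)"

text \<open>
  The feasible set contains the prescribed starting point \<open>0\<close> of the algorithms.  (With an
  infeasible starting point allowed, the class would be larger and the complexity below could
  only increase.)  \<open>bounded\<close> is explicit because \<open>diameter\<close> is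
  unspecified on unbounded sets.
\<close>

definition problem_class :: "nat \<Rightarrow> real \<Rightarrow> real \<Rightarrow> real \<Rightarrow> problem set" where
  "problem_class n R L \<mu> = {P.
     feasible P \<subseteq> Rn (pdim P) \<and> closed (feasible P) \<and> convex (feasible P) \<and> 0 \<in> feasible P \<and>
     bounded (feasible P) \<and> diameter (feasible P) \<le> 2 * R \<and>
     (\<forall>i\<in>{1..n}. smooth (pdim P) L (component P i)) \<and>
     strongly_convex (pdim P) \<mu> (objective n P)}"

type_synonym pifo_answer = "real \<times> finseq \<times> finseq"
type_synonym fo_answer = "real \<times> finseq"

definition pifo_oracle :: "problem \<Rightarrow> nat \<Rightarrow> real \<Rightarrow> finseq \<Rightarrow> pifo_answer" where
  "pifo_oracle P i \<gamma> x =
     (component P i x, grad (pdim P) (component P i) x, prox (pdim P) (component P i) \<gamma> x)"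

definition fo_oracle :: "nat \<Rightarrow> problem \<Rightarrow> finseq \<Rightarrow> fo_answer" where
  "fo_oracle n P x = (objective n P x, grad (pdim P) (objective n P) x)"


text \<open>
  What was learnt from the oracles at step \<open>t\<close>: \<open>obs_pifo\<close> lists the answers of component
  \<open>obs_index\<close> with parameter \<open>obs_gamma\<close> at \<open>x\<^sub>0, \<dots>, x\<^bsub>t-1\<^esub>\<close>; \<open>obs_fo\<close> is the answer of
  the full oracle at \<open>x\<^bsub>t-1\<^esub>\<close>, if the coin came up.
\<close>

record observation =
  obs_index :: nat
  obs_gamma :: real
  obs_pifo :: "pifo_answer list"
  obs_fo :: "fo_answer option"

text \<open>
  All that the algorithm knows: dimension, feasible set, full oracle answer at
  \<open>x\<^sub>0\<close> (which is a reference point from the start), observations, and iterates from \<open>x\<^sub>0\<close> on.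
\<close>

record transcript =
  tr_dim :: nat
  tr_feasible :: "finseq set"
  tr_fo0 :: fo_answer
  tr_obs :: "observation list"
  tr_points :: "finseq list"

definition tr_directions :: "transcript \<Rightarrow> finseq set" where
  "tr_directions tr =
     set (tr_points tr)
     \<union> {g. \<exists>ob\<in>set (tr_obs tr). \<exists>v p. (v, g, p) \<in> set (obs_pifo ob)}
     \<union> {p. \<exists>ob\<in>set (tr_obs tr). \<exists>v g. (v, g, p) \<in> set (obs_pifo ob)}
     \<union> {g. \<exists>ob\<in>set (tr_obs tr). \<exists>v. obs_fo ob = Some (v, g)}
     \<union> {snd (tr_fo0 tr)}"

text \<open>
  \<open>gamma_rule\<close> picks \<open>\<gamma>\<^sub>t\<close> from the transcript of the steps before \<open>t\<close> and the index \<open>i\<^sub>t\<close>;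
  \<open>point_rule\<close> picks the unprojected point from the iterates before step \<open>t\<close> and
  the observations up to step \<open>t\<close>.  Stopping with output \<open>x\<^sub>t\<close> needs no separate provision:
  it amounts to choosing \<open>x\<^sub>t\<close> again at all later steps.
\<close>

record pifo_alg =
  index_dist :: "nat pmf"
  coin_prob :: real
  gamma_rule :: "transcript \<Rightarrow> nat \<Rightarrow> real"
  point_rule :: "transcript \<Rightarrow> finseq"

definition pifo_algorithms :: "real \<Rightarrow> nat \<Rightarrow> pifo_alg set" where
  "pifo_algorithms c0 n = {A.
     set_pmf (index_dist A) \<subseteq> {1..n} \<and>
     0 < coin_prob A \<and> coin_prob A \<le> 1 \<and> coin_prob A \<le> c0 / real n \<and>
     (\<forall>tr i. gamma_rule A tr i > 0) \<and>
     (\<forall>tr. point_rule A tr \<in> span (tr_directions tr))}"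

definition initial_transcript :: "nat \<Rightarrow> problem \<Rightarrow> transcript" where
  "initial_transcript n P =
     \<lparr>tr_dim = pdim P, tr_feasible = feasible P, tr_fo0 = fo_oracle n P 0,
      tr_obs = [], tr_points = [0]\<rparr>"

definition pifo_step :: "nat \<Rightarrow> pifo_alg \<Rightarrow> problem \<Rightarrow> transcript \<Rightarrow> nat \<times> bool \<Rightarrow> transcript" where
  "pifo_step n A P tr = (\<lambda>(i, a).
     let \<gamma> = gamma_rule A tr i;
         xs = tr_points tr;
         ob = \<lparr>obs_index = i, obs_gamma = \<gamma>, obs_pifo = map (pifo_oracle P i \<gamma>) xs,
               obs_fo = (if a then Some (fo_oracle n P (last xs)) else None)\<rparr>;
         tr' = tr\<lparr>tr_obs := tr_obs tr @ [ob]\<rparr>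
     in tr'\<lparr>tr_points := xs @ [proj (feasible P) (point_rule A tr')]\<rparr>)"

definition iterate :: "nat \<Rightarrow> pifo_alg \<Rightarrow> problem \<Rightarrow> (nat \<times> bool) list \<Rightarrow> finseq" where
  "iterate n A P \<omega> = last (tr_points (foldl (pifo_step n A P) (initial_transcript n P) \<omega>))"


text \<open>
  The iterate at time \<open>T\<close> depends on \<open>(i\<^sub>1, a\<^sub>1), \<dots>, (i\<^sub>T, a\<^sub>T)\<close> only, whose joint law is
  the \<open>T\<close>-fold product law \<open>replicate_pmf\<close>.
\<close>

definition expected_value :: "nat \<Rightarrow> pifo_alg \<Rightarrow> problem \<Rightarrow> nat \<Rightarrow> real" where
  "expected_value n A P T =
     measure_pmf.expectation
       (replicate_pmf T (pair_pmf (index_dist A) (bernoulli_pmf (coin_prob A))))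
       (\<lambda>\<omega>. objective n P (iterate n A P \<omega>))"

definition hitting_time :: "nat \<Rightarrow> pifo_alg \<Rightarrow> problem \<Rightarrow> real \<Rightarrow> enat" where
  "hitting_time n A P \<epsilon> =
     Inf {enat T |T. expected_value n A P T - (INF x\<in>feasible P. objective n P x) < \<epsilon>}"

definition minimax_complexity :: "real \<Rightarrow> nat \<Rightarrow> real \<Rightarrow> real \<Rightarrow> real \<Rightarrow> real \<Rightarrow> enat" where
  "minimax_complexity c0 n \<epsilon> R L \<mu> =
     (INF A\<in>pifo_algorithms c0 n. SUP P\<in>problem_class n R L \<mu>. hitting_time n A P \<epsilon>)"

end

theory Submission
  imports Defs
begin

text \<open>
  Since the scale \<open>s\<close> may depend on everything but \<open>\<epsilon>\<close>, what has to be shown is a lower bound on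
  the rate: halving the error costs a number of steps of the order of \<open>sqrt (\<kappa> * n)\<close>, respectively
  of \<open>n / (1 + max 0 (ln (n / \<kappa>)))\<close>.  The additive \<open>n\<close> is absorbed into \<open>s\<close> in the second case, and
  in the first case \<open>n\<close> is at most a constant multiple of \<open>sqrt (\<kappa> * n)\<close>.

  The hard instance is a chain of springs whose equilibrium has displacements \<open>C * q ^ k\<close>.  Given an
  algorithm, some index \<open>i0\<close> is sampled with probability at most \<open>1 / n\<close>.  Every other spring of the
  chain is put into the component \<open>i0\<close>, the remaining ones into another component \<open>j0\<close>; all other
  components contain only \<open>\<mu> / 2 * (norm x)\<^sup>2\<close> and the linear term.  Gradients, proximal points and
  projections move the support of the iterates only across springs of the queried component
  (\<open>grad_in_Rn_of_trunc_le\<close>, \<open>prox_in_Rn_of_trunc_le\<close>, \<open>proj_ball_in_Rn\<close>): truncating a vector where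
  no spring of the component crosses never increases that component.  So the support grows, by two
  coordinates, only in steps that query \<open>i0\<close> or the full gradient (\<open>directions_in_reach\<close>), and a step
  does so with probability at most \<open>(1 + c0) / n\<close>.  After \<open>N\<close> such steps the error is at least a
  constant times \<open>q ^ (4 * N)\<close> by strong convexity; by convexity of the exponential, its mean is at
  least that constant times \<open>q powr (4 * T * (1 + c0) / n)\<close> (\<open>expected_gap\<close>).  Therefore the complexity
  is at least \<open>n * ln (s / \<epsilon>) / (4 * (1 + c0) * ln (1 / q))\<close> (\<open>minimax_complexity_ge\<close>).

  It remains to take \<open>q\<close> as large as smoothness permits: the condition is \<open>q / (1 - q)\<^sup>2 \<le> \<kappa> / (4 * n)\<close>,
  and \<open>decay_rate\<close> finds a \<open>q\<close> for which \<open>ln (1 / q)\<close> is bounded by both \<open>6 * sqrt (n / \<kappa>)\<close> and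
  \<open>3 * (1 + max 0 (ln (n / \<kappa>)))\<close>.
\<close>

section \<open>Coordinates and truncation\<close>

lemma Rn_subspace: "subspace (Rn d)"
  by (auto simp: subspace_def Rn_def)

lemma Rn_mono: "m \<le> m' \<Longrightarrow> Rn m \<subseteq> Rn m'"
  by (auto simp: Rn_def)

definition unit_vec :: "nat \<Rightarrow> finseq" where
  "unit_vec k = Abs_finseq (\<lambda>i. if i = k then 1 else 0)"

lemma coord_unit_vec [simp]: "coord (unit_vec k) i = (if i = k then 1 else 0)"
  unfolding unit_vec_def by (subst coord_Abs) auto

lemma inner_unit_vec [simp]: "inner (unit_vec k) x = coord x k"
proof -
  have "inner (unit_vec k) x = (\<Sum>i\<in>{k}. coord (unit_vec k) i * coord x i)"
    by (rule inner_finseq_superset) auto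
  then show ?thesis by simp
qed

lemma coord_sum [simp]: "coord (\<Sum>k\<in>S. f k) i = (\<Sum>k\<in>S. coord (f k) i)"
  by (induction S rule: infinite_finite_induct) auto

lemma norm_unit_vec [simp]: "norm (unit_vec k) = 1"
  by (simp add: norm_eq_sqrt_inner)

lemma abs_coord_le_norm: "\<bar>coord x k\<bar> \<le> norm x"
  using Cauchy_Schwarz_ineq2[of "unit_vec k" x] by simp

definition trunc :: "nat \<Rightarrow> finseq \<Rightarrow> finseq" where
  "trunc m x = Abs_finseq (\<lambda>i. if i < m then coord x i else 0)"

lemma coord_trunc [simp]: "coord (trunc m x) i = (if i < m then coord x i else 0)"
  unfolding trunc_def by (subst coord_Abs) auto

lemma trunc_in_Rn: "x \<in> Rn d \<Longrightarrow> trunc m x \<in> Rn m \<inter> Rn d"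
  by (auto simp: Rn_def)

lemma norm_minus_trunc:
  assumes "x \<in> Rn m"
  shows "(norm (x - u))\<^sup>2 = (norm (x - trunc m u))\<^sup>2 + (norm (u - trunc m u))\<^sup>2"
proof -
  have "inner y (u - trunc m u) = 0" if "y \<in> Rn m" for y
    unfolding inner_finseq_def
    by (rule sum.neutral) (use that in \<open>auto simp: Rn_def not_less\<close>)
  moreover have "x - trunc m u \<in> Rn m"
    using assms by (auto simp: Rn_def)
  ultimately have "orthogonal (x - trunc m u) (trunc m u - u)"
    unfolding orthogonal_def by (metis inner_minus_right minus_diff_eq neg_equal_0_iff_equal)
  from norm_add_Pythagorean[OF this] show ?thesis
    by (simp add: norm_minus_commute)
qed

lemma norm_trunc_le: "norm (trunc m u) \<le> norm u"
proof -
  have "(norm u)\<^sup>2 = (norm (trunc m u))\<^sup>2 + (norm (u - trunc m u))\<^sup>2"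
    using norm_minus_trunc[of 0 m u] by (simp add: Rn_def)
  then show ?thesis
    by (metis le_add_same_cancel1 norm_ge_zero power2_le_imp_le zero_le_power2)
qed

lemma closed_Rn: "closed (Rn d)"
proof -
  have "Rn d = (\<Inter>i\<in>{d..}. {x. inner (unit_vec i) x = 0})"
    by (auto simp: Rn_def)
  also have "closed \<dots>"
    by (intro closed_INT ballI closed_Collect_eq continuous_intros)
  finally show ?thesis .
qed

text \<open>
  Differentiability within the subspace determines the gradient only because the gradient is
  required to lie in the subspace: two candidates agree on all lines of direction in \<open>Rn d\<close>,
  in particular on the direction of their difference.
\<close>

lemma grad_eqI:
  assumes der: "(g has_derivative inner v) (at x within Rn d)"
    and v: "v \<in> Rn d" and x: "x \<in> Rn d"
  shows "grad d g x = v"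
  unfolding grad_def
proof (rule the_equality)
  show "v \<in> Rn d \<and> (g has_derivative (\<lambda>h. inner v h)) (at x within Rn d)"
    using der v by simp
next
  have line: "((\<lambda>t. g (x + t *\<^sub>R h)) has_derivative (\<lambda>t. t * inner u h)) (at 0)"
    if "(g has_derivative (\<lambda>h. inner u h)) (at x within Rn d)" "h \<in> Rn d" for u h
  proof -
    have 1: "((\<lambda>t::real. x + t *\<^sub>R h) has_derivative (\<lambda>t. t *\<^sub>R h)) (at 0)"
      by (auto intro!: derivative_eq_intros)
    have 2: "(\<lambda>t. x + t *\<^sub>R h) ` UNIV \<subseteq> Rn d"
      using that(2) x by (auto simp: Rn_def)
    have "(g has_derivative (\<lambda>h. inner u h)) (at (x + 0 *\<^sub>R h) within (\<lambda>t. x + t *\<^sub>R h) ` UNIV)"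
      using has_derivative_subset[OF that(1) 2] by simp
    from has_derivative_in_compose[OF 1 this] show ?thesis
      by simp
  qed
  fix w assume w: "w \<in> Rn d \<and> (g has_derivative (\<lambda>h. inner w h)) (at x within Rn d)"
  have h: "w - v \<in> Rn d"
    using w v by (auto simp: Rn_def)
  have "(\<lambda>t. t * inner w (w - v)) = (\<lambda>t. t * inner v (w - v))"
    using has_derivative_unique[OF line line] w der h by blast
  then have "inner w (w - v) = inner v (w - v)"
    by (metis mult_1)
  then have "inner (w - v) (w - v) = 0"
    by (simp add: inner_diff_left)
  then show "w = v" by simp
qed

text \<open>
  The hypothesis \<open>cut\<close> says that erasing the coordinates from \<open>m\<close> on never increases
  \<open>g\<close>; by this property the answers of a component are confined to \<open>Rn m\<close>.
  For the gradient at \<open>x \<in> Rn m\<close>: along a coordinate line of direction \<open>k \<ge> m\<close>, truncation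
  returns the point to \<open>x\<close>, so \<open>g\<close> is minimal at \<open>x\<close> on that line and its slope there vanishes.
\<close>

lemma grad_in_Rn_of_trunc_le:
  assumes der: "(g has_derivative inner v) (at x within Rn d)"
    and v: "v \<in> Rn d" and x: "x \<in> Rn m \<inter> Rn d"
    and cut: "\<And>u. u \<in> Rn d \<Longrightarrow> g (trunc m u) \<le> g u"
  shows "v \<in> Rn m"
  unfolding Rn_def
proof safe
  fix k assume k: "m \<le> k"
  show "coord v k = 0"
  proof (cases "k < d")
    case False
    with v show ?thesis by (simp add: Rn_def)
  next
    case True
    have line: "x + t *\<^sub>R unit_vec k \<in> Rn d" for t
      using x True by (auto simp: Rn_def)
    have "trunc m (x + t *\<^sub>R unit_vec k) = x" for t
      using x k by (intro finseq_eqI) (auto simp: Rn_def)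
    then have min: "g x \<le> g (x + t *\<^sub>R unit_vec k)" for t
      using cut[OF line, of t] by simp
    have 1: "((\<lambda>t::real. x + t *\<^sub>R unit_vec k) has_derivative (\<lambda>t. t *\<^sub>R unit_vec k)) (at 0)"
      by (auto intro!: derivative_eq_intros)
    have "(g has_derivative inner v) (at (x + 0 *\<^sub>R unit_vec k) within (\<lambda>t. x + t *\<^sub>R unit_vec k) ` UNIV)"
      using line by (auto intro: has_derivative_subset[OF der])
    from has_derivative_in_compose[OF 1 this]
    have "((\<lambda>t. g (x + t *\<^sub>R unit_vec k)) has_derivative (\<lambda>t. t * coord v k)) (at 0)"
      by (simp add: inner_commute[of v])
    moreover have "(\<lambda>t. t * coord v k) = (*) (coord v k)"
      by (rule ext) (rule mult.commute)
    ultimately have "((\<lambda>t. g (x + t *\<^sub>R unit_vec k)) has_real_derivative coord v k) (at 0)"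
      by (simp only: has_field_derivative_def)
    from DERIV_local_min[OF this, of 1] min show ?thesis
      by simp
  qed
qed

text \<open>
  Truncating the proximal point does not increase \<open>g\<close>, and by Pythagoras it brings the point
  strictly closer to \<open>x\<close> unless it was in \<open>Rn m\<close> already.
\<close>

lemma prox_in_Rn_of_trunc_le:
  assumes cut: "\<And>u. u \<in> Rn d \<Longrightarrow> g (trunc m u) \<le> g u"
    and x: "x \<in> Rn m" and \<gamma>: "\<gamma> > 0"
  shows "prox d g \<gamma> x \<in> Rn m \<inter> Rn d"
proof (cases "convex_on (Rn d) (prox_objective g \<gamma> x)
         \<and> (\<exists>u. is_arg_min (prox_objective g \<gamma> x) (\<lambda>u. u \<in> Rn d) u)")
  case False
  then show ?thesis by (auto simp: prox_def Rn_def)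
next
  case True
  define p where "p = prox d g \<gamma> x"
  have "p = arg_min_on (prox_objective g \<gamma> x) (Rn d)"
    using True by (simp add: p_def prox_def)
  then have "is_arg_min (prox_objective g \<gamma> x) (\<lambda>u. u \<in> Rn d) p"
    using True unfolding arg_min_on_def arg_min_def by (metis someI_ex)
  then have p: "p \<in> Rn d"
    and min: "\<And>u. u \<in> Rn d \<Longrightarrow> prox_objective g \<gamma> x p \<le> prox_objective g \<gamma> x u"
    by (auto simp: is_arg_min_def not_less)
  have "prox_objective g \<gamma> x p \<le> prox_objective g \<gamma> x (trunc m p)"
    using min trunc_in_Rn[OF p] by blast
  then have "1 / (2 * \<gamma>) * (norm (p - trunc m p))\<^sup>2 \<le> 0"
    using cut[OF p] unfolding prox_objective_def norm_minus_trunc[OF x, of p]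
    by (simp add: algebra_simps)
  with \<gamma> have "p = trunc m p"
    by (simp add: mult_le_0_iff divide_le_0_iff)
  then show ?thesis
    unfolding p_def[symmetric] using trunc_in_Rn[OF p, of m] by simp
qed

text \<open>
  Again truncation would improve a nearest point outside \<open>Rn m\<close>.  A nearest point has to be
  exhibited, because \<^const>\<open>proj\<close> is an arbitrary point if none exists; rescaling \<open>x\<close> gives one.
\<close>

lemma proj_ball_in_Rn:
  assumes x: "x \<in> Rn m \<inter> Rn d" and R: "R > 0"
  shows "proj (Rn d \<inter> cball 0 R) x \<in> Rn m \<inter> (Rn d \<inter> cball 0 R)"
proof -
  let ?X = "Rn d \<inter> cball 0 R"
  define z where "z = (if norm x \<le> R then x else (R / norm x) *\<^sub>R x)"
  have zX: "z \<in> ?X"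
    using x R by (auto simp: z_def Rn_def)
  have "dist x z \<le> dist x y" if "y \<in> ?X" for y
  proof (cases "norm x \<le> R")
    case True
    then show ?thesis by (simp add: z_def)
  next
    case False
    then have "x - z = (1 - R / norm x) *\<^sub>R x"
      by (simp add: z_def scaleR_diff_left)
    moreover have "0 < norm x"
      using False R by linarith
    moreover have "R / norm x \<le> 1"
      using False R by (subst divide_le_eq_1) auto
    ultimately have "dist x z = norm x - R"
      by (simp add: dist_norm left_diff_distrib)
    also have "\<dots> \<le> norm x - norm y"
      using that by simp
    also have "\<dots> \<le> dist x y"
      by (simp add: dist_norm norm_triangle_ineq2)
    finally show ?thesis .
  qed
  then have "is_arg_min (dist x) (\<lambda>u. u \<in> ?X) z"
    using zX by (auto simp: is_arg_min_def not_less)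
  then have "is_arg_min (dist x) (\<lambda>u. u \<in> ?X) (proj ?X x)"
    unfolding proj_def arg_min_on_def arg_min_def by (metis someI_ex)
  then have p: "proj ?X x \<in> ?X"
    and min: "\<And>u. u \<in> ?X \<Longrightarrow> dist x (proj ?X x) \<le> dist x u"
    by (auto simp: is_arg_min_def not_less)
  have tX: "trunc m (proj ?X x) \<in> ?X"
    using p trunc_in_Rn[of "proj ?X x" d m] norm_trunc_le[of m "proj ?X x"] by auto
  have "(dist x (proj ?X x))\<^sup>2 \<le> (dist x (trunc m (proj ?X x)))\<^sup>2"
    using min[OF tX] by (simp add: power_mono)
  then have "(norm (proj ?X x - trunc m (proj ?X x)))\<^sup>2 \<le> 0"
    using x unfolding dist_norm by (subst (asm) norm_minus_trunc[of x m]) auto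
  then have "proj ?X x = trunc m (proj ?X x)"
    by simp
  then show ?thesis
    using p trunc_in_Rn[of "proj ?X x" d m] by auto
qed

section \<open>Quadratics with orthogonal squared terms\<close>

definition quad :: "real \<Rightarrow> 'a::real_inner \<Rightarrow> ('k \<Rightarrow> 'a) \<Rightarrow> 'k set \<Rightarrow> 'a \<Rightarrow> real" where
  "quad \<mu> b v S x = \<mu> / 2 * (norm x)\<^sup>2 + (\<Sum>k\<in>S. (inner (v k) x)\<^sup>2) / 2 - inner b x"

definition quad_grad :: "real \<Rightarrow> 'a::real_inner \<Rightarrow> ('k \<Rightarrow> 'a) \<Rightarrow> 'k set \<Rightarrow> 'a \<Rightarrow> 'a" where
  "quad_grad \<mu> b v S x = \<mu> *\<^sub>R x + (\<Sum>k\<in>S. inner (v k) x *\<^sub>R v k) - b"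

lemma quad_expand:
  "quad \<mu> b v S (x + h) = quad \<mu> b v S x + inner (quad_grad \<mu> b v S x) h
     + \<mu> / 2 * (norm h)\<^sup>2 + (\<Sum>k\<in>S. (inner (v k) h)\<^sup>2) / 2"
proof -
  have "(\<Sum>k\<in>S. (inner (v k) (x + h))\<^sup>2) = (\<Sum>k\<in>S. (inner (v k) x)\<^sup>2)
      + 2 * (\<Sum>k\<in>S. inner (v k) x * inner (v k) h) + (\<Sum>k\<in>S. (inner (v k) h)\<^sup>2)"
    by (simp add: inner_add_right power2_sum sum.distrib sum_distrib_left mult.assoc)
  moreover have "(norm (x + h))\<^sup>2 = (norm x)\<^sup>2 + 2 * inner x h + (norm h)\<^sup>2"
    by (simp add: power2_norm_eq_inner inner_add_left inner_add_right inner_commute)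
  ultimately show ?thesis
    by (simp add: quad_def quad_grad_def inner_add_left inner_diff_left inner_sum_left
        inner_add_right field_simps)
qed

lemma has_derivative_quad:
  "(quad \<mu> b v S has_derivative inner (quad_grad \<mu> b v S x)) (at x within X)"
proof -
  have "(quad \<mu> b v S has_derivative (\<lambda>h. \<mu> / 2 * (inner x h + inner h x)
      + (\<Sum>k\<in>S. 2 * (inner (v k) x * inner (v k) h)) / 2 - inner b h)) (at x within X)"
    unfolding quad_def[abs_def] power2_norm_eq_inner unfolding power2_eq_square
    by (auto intro!: derivative_eq_intros sum.cong simp: algebra_simps)
  also have "(\<lambda>h. \<mu> / 2 * (inner x h + inner h x)
      + (\<Sum>k\<in>S. 2 * (inner (v k) x * inner (v k) h)) / 2 - inner b h)
    = inner (quad_grad \<mu> b v S x)"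
    by (rule ext) (simp add: quad_grad_def inner_add_left inner_diff_left inner_sum_left
        inner_commute[of _ x] sum_distrib_left[symmetric])
  finally show ?thesis .
qed

text \<open>
  The Hessian of the squared-links part is positive semidefinite with eigenvectors \<open>v k\<close> and
  eigenvalues \<open>(norm (v k))\<^sup>2\<close>, because the \<open>v k\<close> are orthogonal.  In the hard instance
  two links of the same component never share a coordinate, so that this applies to it.
\<close>

lemma norm_orthogonal_sum_le:
  fixes v :: "'k \<Rightarrow> 'a::real_inner"
  assumes "finite S"
    and orth: "\<And>k l. k \<in> S \<Longrightarrow> l \<in> S \<Longrightarrow> k \<noteq> l \<Longrightarrow> inner (v k) (v l) = 0"
    and bound: "\<And>k. k \<in> S \<Longrightarrow> (norm (v k))\<^sup>2 \<le> c"
    and "0 \<le> c"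
  shows "norm (\<Sum>k\<in>S. inner (v k) h *\<^sub>R v k) \<le> c * norm h"
proof -
  define z where "z = (\<Sum>k\<in>S. inner (v k) h *\<^sub>R v k)"
  have z: "inner (v k) z = inner (v k) h * (norm (v k))\<^sup>2" if "k \<in> S" for k
  proof -
    have "inner (v k) z = (\<Sum>l\<in>S. if l = k then inner (v k) h * (norm (v k))\<^sup>2 else 0)"
      unfolding z_def inner_sum_right
      by (rule sum.cong) (use orth that in \<open>auto simp: power2_norm_eq_inner\<close>)
    then show ?thesis using that \<open>finite S\<close> by simp
  qed
  have "(norm z)\<^sup>2 = (\<Sum>k\<in>S. inner (v k) h * inner (v k) z)"
    unfolding power2_norm_eq_inner by (subst (1) z_def) (simp add: inner_sum_left)
  also have "\<dots> = (\<Sum>k\<in>S. (inner (v k) h)\<^sup>2 * (norm (v k))\<^sup>2)"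
    by (rule sum.cong) (simp_all add: z power2_eq_square)
  also have "\<dots> \<le> (\<Sum>k\<in>S. (inner (v k) h)\<^sup>2 * c)"
    by (rule sum_mono) (simp add: bound mult_left_mono)
  also have "\<dots> = c * inner z h"
    by (simp add: z_def inner_sum_left sum_distrib_left power2_eq_square mult.commute)
  also have "\<dots> \<le> c * (norm z * norm h)"
    using \<open>0 \<le> c\<close> by (intro mult_left_mono norm_cauchy_schwarz)
  finally have *: "norm z * norm z \<le> norm z * (c * norm h)"
    by (simp add: power2_eq_square algebra_simps)
  show ?thesis
  proof (cases "z = 0")
    case True
    then show ?thesis using \<open>0 \<le> c\<close> by (simp add: z_def)
  next
    case False
    then have "0 < norm z" by simp
    from mult_left_le_imp_le[OF * this] show ?thesis by (simp add: z_def)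
  qed
qed

lemma quad_grad_diff:
  "quad_grad \<mu> b v S x - quad_grad \<mu> b v S y
     = \<mu> *\<^sub>R (x - y) + (\<Sum>k\<in>S. inner (v k) (x - y) *\<^sub>R v k)"
  by (simp add: quad_grad_def inner_diff_right scaleR_diff_left scaleR_diff_right sum_subtractf)

lemma quad_grad_in_Rn:
  assumes "\<And>k. k \<in> S \<Longrightarrow> v k \<in> Rn d" "b \<in> Rn d" "x \<in> Rn d"
  shows "quad_grad \<mu> b v S x \<in> Rn d"
  unfolding quad_grad_def using assms
  by (intro subspace_diff subspace_add subspace_sum subspace_scale Rn_subspace)

lemma smooth_quad:
  assumes "finite S" "\<And>k. k \<in> S \<Longrightarrow> v k \<in> Rn d" "b \<in> Rn d"
    and orth: "\<And>k l. k \<in> S \<Longrightarrow> l \<in> S \<Longrightarrow> k \<noteq> l \<Longrightarrow> inner (v k) (v l) = 0"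
    and bound: "\<And>k. k \<in> S \<Longrightarrow> (norm (v k))\<^sup>2 \<le> L - \<mu>"
    and "0 \<le> \<mu>" "\<mu> \<le> L"
  shows "smooth d L (quad \<mu> b v S)"
proof -
  have Rn: "quad_grad \<mu> b v S x \<in> Rn d" if "x \<in> Rn d" for x
    using assms(2,3) that by (rule quad_grad_in_Rn)
  have grad: "grad d (quad \<mu> b v S) x = quad_grad \<mu> b v S x" if "x \<in> Rn d" for x
    by (rule grad_eqI[OF has_derivative_quad Rn[OF that] that])
  have "L-lipschitz_on (Rn d) (grad d (quad \<mu> b v S))"
  proof (rule lipschitz_onI)
    fix x y assume xy: "x \<in> Rn d" "y \<in> Rn d"
    have "norm (quad_grad \<mu> b v S x - quad_grad \<mu> b v S y)
       \<le> norm (\<mu> *\<^sub>R (x - y)) + norm (\<Sum>k\<in>S. inner (v k) (x - y) *\<^sub>R v k)"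
      unfolding quad_grad_diff by (rule norm_triangle_ineq)
    also have "\<dots> \<le> \<mu> * norm (x - y) + (L - \<mu>) * norm (x - y)"
      using norm_orthogonal_sum_le[OF assms(1) orth bound, where h = "x - y"] assms by simp
    finally show "dist (grad d (quad \<mu> b v S) x) (grad d (quad \<mu> b v S) y) \<le> L * dist x y"
      by (simp add: grad xy dist_norm algebra_simps)
  qed (use assms in auto)
  moreover have "quad \<mu> b v S differentiable_on Rn d"
    unfolding differentiable_on_def differentiable_def using has_derivative_quad by blast
  ultimately show ?thesis by (simp add: smooth_def)
qed

lemma convex_on_sum_fun:
  assumes "convex C" "\<And>i. i \<in> S \<Longrightarrow> convex_on C (f i)"
  shows "convex_on C (\<lambda>x. \<Sum>i\<in>S. f i x)"
  using assms(2)
  by (induction S rule: infinite_finite_induct) (auto simp: convex_on_const assms(1))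

lemma convex_on_quad_0:
  assumes "convex X"
  shows "convex_on X (quad 0 b v S)"
proof (rule convex_onI)
  fix t :: real and x y assume t: "0 < t" "t < 1"
  have sq: "((1 - t) * p + t * r)\<^sup>2 \<le> (1 - t) * p\<^sup>2 + t * r\<^sup>2" for p r :: real
  proof -
    have "(1 - t) * p\<^sup>2 + t * r\<^sup>2 - ((1 - t) * p + t * r)\<^sup>2 = t * (1 - t) * (p - r)\<^sup>2"
      by (simp add: power2_eq_square algebra_simps)
    also have "\<dots> \<ge> 0" using t by simp
    finally show ?thesis by simp
  qed
  have "(\<Sum>k\<in>S. (inner (v k) ((1 - t) *\<^sub>R x + t *\<^sub>R y))\<^sup>2)
     \<le> (\<Sum>k\<in>S. (1 - t) * (inner (v k) x)\<^sup>2 + t * (inner (v k) y)\<^sup>2)"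
    by (rule sum_mono) (simp add: inner_add_right sq)
  also have "\<dots> = (1 - t) * (\<Sum>k\<in>S. (inner (v k) x)\<^sup>2) + t * (\<Sum>k\<in>S. (inner (v k) y)\<^sup>2)"
    by (simp add: sum.distrib sum_distrib_left)
  finally have sums: "(\<Sum>k\<in>S. (inner (v k) ((1 - t) *\<^sub>R x + t *\<^sub>R y))\<^sup>2) / 2
     \<le> (1 - t) * ((\<Sum>k\<in>S. (inner (v k) x)\<^sup>2) / 2) + t * ((\<Sum>k\<in>S. (inner (v k) y)\<^sup>2) / 2)"
    by simp
  have lin: "inner b ((1 - t) *\<^sub>R x + t *\<^sub>R y) = (1 - t) * inner b x + t * inner b y"
    by (simp only: inner_add_right inner_scaleR_right)
  show "quad 0 b v S ((1 - t) *\<^sub>R x + t *\<^sub>R y) \<le> (1 - t) * quad 0 b v S x + t * quad 0 b v S y"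
    using sums unfolding quad_def lin right_diff_distrib[of "1 - t"] right_diff_distrib[of t] by simp
qed fact

section \<open>Counting successes\<close>

lemma finite_set_replicate_pmf:
  assumes "finite (set_pmf p)"
  shows "finite (set_pmf (replicate_pmf T p))"
  unfolding set_replicate_pmf using finite_lists_length_eq[OF assms, of T]
  by (rule rev_finite_subset) (auto simp: lists_eq_set)

lemma expectation_successes:
  assumes fin: "finite (set_pmf p)"
  shows "measure_pmf.expectation (replicate_pmf T p) (\<lambda>\<omega>. real (length (filter Q \<omega>)))
     = real T * measure_pmf.prob p {x. Q x}"
proof (induction T)
  case 0
  show ?case by simp
next
  case (Suc T)
  have finR: "finite (set_pmf (replicate_pmf T p))"
    using fin by (rule finite_set_replicate_pmf)
  let ?M = "pair_pmf p (replicate_pmf T p)"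
  have int: "integrable (measure_pmf ?M) f" for f :: "_ \<Rightarrow> real"
    by (rule integrable_measure_pmf_finite) (simp add: fin finR)
  have eq: "replicate_pmf (Suc T) p = map_pmf (\<lambda>(x, xs). x # xs) ?M"
    by (simp add: pair_pmf_def map_pmf_def bind_assoc_pmf bind_return_pmf)
  have "measure_pmf.expectation (replicate_pmf (Suc T) p) (\<lambda>\<omega>. real (length (filter Q \<omega>)))
     = measure_pmf.expectation ?M (\<lambda>z. indicator {x. Q x} (fst z) + real (length (filter Q (snd z))))"
    unfolding eq integral_map_pmf by (rule Bochner_Integration.integral_cong) (auto simp: indicator_def)
  also have "\<dots> = measure_pmf.expectation ?M (\<lambda>z. indicator {x. Q x} (fst z))
      + measure_pmf.expectation ?M (\<lambda>z. real (length (filter Q (snd z))))"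
    by (rule Bochner_Integration.integral_add) (rule int)+
  also have "measure_pmf.expectation ?M (\<lambda>z. indicator {x. Q x} (fst z) :: real)
      = measure_pmf.expectation (map_pmf fst ?M) (indicator {x. Q x})"
    by (simp only: integral_map_pmf)
  also have "\<dots> = measure_pmf.prob p {x. Q x}"
    unfolding map_fst_pair_pmf by simp
  also have "measure_pmf.expectation ?M (\<lambda>z. real (length (filter Q (snd z))))
      = measure_pmf.expectation (map_pmf snd ?M) (\<lambda>\<omega>. real (length (filter Q \<omega>)))"
    by (simp only: integral_map_pmf)
  also have "\<dots> = real T * measure_pmf.prob p {x. Q x}"
    unfolding map_snd_pair_pmf by (rule Suc.IH)
  finally show ?case by (simp add: algebra_simps)
qed

section \<open>The chain of springs\<close>

text \<open>
  The chain: coordinate \<open>k\<close> is tied to coordinate \<open>k + 1\<close> by a spring, even springs belonging to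
  component \<open>i0\<close> and odd ones to \<open>j0\<close>, and a force acts on coordinate \<open>0\<close>.  The assumption
  \<open>smoothness\<close> makes the springs soft enough for \<open>L\<close>-smooth components: \<open>stiffness\<close> below, its
  left-hand side, is the value for which the displacements in equilibrium decay by exactly the
  factor \<open>q\<close> per spring.
\<close>

locale hard_instance =
  fixes n :: nat and L \<mu> R q :: real and d i0 j0 :: nat
  assumes owners: "i0 \<in> {1..n}" "j0 \<in> {1..n}" "i0 \<noteq> j0"
    and pos: "0 < \<mu>" "0 < R" "0 < q" "q < 1" "0 < d"
    and smoothness: "2 * \<mu> \<le> L" "real n * \<mu> * q / (1 - q)\<^sup>2 \<le> L / 4"
begin

definition stiffness :: real where
  "stiffness = real n * \<mu> * q / (1 - q)\<^sup>2"

text \<open>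
  The spring from \<open>k\<close> to \<open>k + 1\<close> has energy \<open>(inner (link k) x)\<^sup>2 / 2\<close>.  The last coordinate is tied
  to the origin by the factor \<open>1 - q\<close>, which replaces the missing rest of an infinite chain: in
  equilibrium that rest would pull with the same force.
\<close>

definition link :: "nat \<Rightarrow> finseq" where
  "link k = (if Suc k < d then sqrt stiffness *\<^sub>R (unit_vec k - unit_vec (Suc k))
             else sqrt (stiffness * (1 - q)) *\<^sub>R unit_vec k)"

definition owner :: "nat \<Rightarrow> nat" where
  "owner k = (if even k then i0 else j0)"

definition links :: "nat \<Rightarrow> nat set" where
  "links i = {k \<in> {..<d}. owner k = i}"

definition amplitude :: real where
  "amplitude = R * (1 - q)"

text \<open>
  The force is scaled so that the equilibrium \<open>sol\<close> has norm at most \<open>R\<close>, whatever the length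
  \<open>d\<close> is; hence the final scale \<open>s\<close> does not depend on \<open>d\<close>, and so not on the accuracy.
\<close>

definition source :: finseq where
  "source = ((\<mu> + stiffness / real n * (1 - q)) * amplitude) *\<^sub>R unit_vec 0"

definition summand :: "nat \<Rightarrow> finseq \<Rightarrow> real" where
  "summand i = quad \<mu> source link (links i)"

definition instance_problem :: problem where
  "instance_problem = \<lparr>pdim = d, feasible = Rn d \<inter> cball 0 R, component = summand\<rparr>"

definition sol :: finseq where
  "sol = (\<Sum>k<d. (amplitude * q ^ k) *\<^sub>R unit_vec k)"

lemma n_pos: "0 < real n"
  using owners by auto

lemma stiffness_pos: "0 < stiffness"
  using pos n_pos by (simp add: stiffness_def)

lemma amplitude_pos: "0 < amplitude"
  using pos by (simp add: amplitude_def)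

lemma finite_links [simp]: "finite (links i)"
  by (simp add: links_def)

lemma inner_link:
  "inner (link k) x = (if Suc k < d then sqrt stiffness * (coord x k - coord x (Suc k))
     else sqrt (stiffness * (1 - q)) * coord x k)"
  by (simp add: link_def inner_diff_left)

lemma coord_link:
  "coord (link k) i = (if Suc k < d
     then sqrt stiffness * ((if i = k then 1 else 0) - (if i = Suc k then 1 else 0))
     else sqrt (stiffness * (1 - q)) * (if i = k then 1 else 0))"
  by (simp add: link_def)

lemma link_in_Rn: "k < d \<Longrightarrow> link k \<in> Rn d"
  by (auto simp: link_def Rn_def)

lemma source_in_Rn: "source \<in> Rn d"
  using pos by (auto simp: source_def Rn_def)

lemma link_orthogonal:
  assumes "k \<in> links i" "l \<in> links i" "k \<noteq> l"
  shows "inner (link k) (link l) = 0"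
proof -
  have "even k = even l"
    using assms owners by (auto simp: links_def owner_def split: if_splits)
  then have "k \<noteq> Suc l" "l \<noteq> Suc k" by auto
  with assms(3) show ?thesis
    by (auto simp: inner_link coord_link)
qed

lemma norm_link_le:
  assumes "k < d"
  shows "(norm (link k))\<^sup>2 \<le> L - \<mu>"
proof -
  have s: "stiffness \<le> L / 4"
    using smoothness by (simp add: stiffness_def)
  have "(norm (link k))\<^sup>2 = (if Suc k < d then 2 * stiffness else stiffness * (1 - q))"
    unfolding power2_norm_eq_inner using stiffness_pos pos
    by (auto simp: inner_link coord_link)
  also have "\<dots> \<le> 2 * stiffness"
  proof -
    have "stiffness * (1 - q) \<le> stiffness * 2"
      using stiffness_pos pos by (intro mult_left_mono) auto
    then show ?thesis by simp
  qed
  also have "\<dots> \<le> L - \<mu>"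
    using s smoothness by simp
  finally show ?thesis .
qed

lemma smooth_summand: "smooth d L (summand i)"
  unfolding summand_def
  using link_in_Rn norm_link_le link_orthogonal source_in_Rn pos smoothness
  by (intro smooth_quad) (auto simp: links_def)

lemma coord_sol: "coord sol i = (if i < d then amplitude * q ^ i else 0)"
  by (simp add: sol_def if_distrib cong: if_cong)

lemma objective_eq:
  "objective n instance_problem x = (\<Sum>i=1..n. summand i x) / real n"
  by (simp add: objective_def instance_problem_def)

lemma sol_in_Rn: "sol \<in> Rn d"
  by (simp add: Rn_def coord_sol)

lemma norm_sol_le: "norm sol \<le> R"
proof -
  have "norm sol \<le> (\<Sum>k<d. norm ((amplitude * q ^ k) *\<^sub>R unit_vec k))"
    unfolding sol_def by (rule norm_sum)
  also have "\<dots> = R * ((1 - q) * (\<Sum>k<d. q ^ k))"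
    using amplitude_pos pos by (simp add: abs_mult sum_distrib_left amplitude_def mult.assoc)
  also have "(1 - q) * (\<Sum>k<d. q ^ k) = 1 - q ^ d"
    by (simp add: one_diff_power_eq)
  also have "R * (1 - q ^ d) \<le> R"
    using pos by simp
  finally show ?thesis .
qed

lemma sum_links: "(\<Sum>i=1..n. \<Sum>k\<in>links i. h k) = (\<Sum>k<d. h k)"
  unfolding links_def using owners by (intro sum.group) (auto simp: owner_def)

lemma link_force:
  assumes "k < d"
  shows "inner (link k) sol *\<^sub>R link k
    = (stiffness * (1 - q) * amplitude * q ^ k) *\<^sub>R
        (unit_vec k - (if Suc k < d then unit_vec (Suc k) else 0))"
proof (cases "Suc k < d")
  case True
  have inner: "inner (link k) sol = sqrt stiffness * ((1 - q) * amplitude * q ^ k)"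
    using True by (simp add: inner_link coord_sol algebra_simps)
  have link: "link k = sqrt stiffness *\<^sub>R (unit_vec k - unit_vec (Suc k))"
    using True by (simp add: link_def)
  have "sqrt stiffness * ((1 - q) * amplitude * q ^ k) * sqrt stiffness
      = stiffness * (1 - q) * amplitude * q ^ k"
    using stiffness_pos by simp
  then show ?thesis
    unfolding inner unfolding link scaleR_scaleR using True by simp
next
  case False
  have inner: "inner (link k) sol = sqrt (stiffness * (1 - q)) * (amplitude * q ^ k)"
    using False assms by (simp add: inner_link coord_sol)
  have link: "link k = sqrt (stiffness * (1 - q)) *\<^sub>R unit_vec k"
    using False by (simp add: link_def)
  have "sqrt (stiffness * (1 - q)) * (amplitude * q ^ k) * sqrt (stiffness * (1 - q))
      = stiffness * (1 - q) * amplitude * q ^ k"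
    using stiffness_pos pos by simp
  then show ?thesis
    unfolding inner unfolding link scaleR_scaleR using False by simp
qed

text \<open>
  The forces balance because \<open>stiffness * (1 - q)\<^sup>2 = n * \<mu> * q\<close>, the characteristic equation of the
  linear recursion satisfied by the displacements.
\<close>

lemma sol_stationary: "(\<Sum>i=1..n. quad_grad \<mu> source link (links i) sol) = 0"
proof -
  define c where "c = stiffness * (1 - q) * amplitude"
  define F where "F = (\<Sum>k<d. inner (link k) sol *\<^sub>R link k)"
  have F: "F = (\<Sum>k<d. (c * q ^ k) *\<^sub>R (unit_vec k - (if Suc k < d then unit_vec (Suc k) else 0)))"
    unfolding F_def c_def by (rule sum.cong) (simp_all add: link_force)
  have coordF: "coord F i = (if i < d then c * q ^ i else 0)
      - (\<Sum>k<d. if Suc k < d \<and> Suc k = i then c * q ^ k else 0)" for i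
  proof -
    have "coord F i = (\<Sum>k<d. (if k = i then c * q ^ k else 0)
        - (if Suc k < d \<and> Suc k = i then c * q ^ k else 0))"
      unfolding F coord_sum by (rule sum.cong) auto
    then show ?thesis by (simp add: sum_subtractf)
  qed
  have s: "stiffness * (1 - q) * (1 - q) = real n * \<mu> * q"
    using pos by (simp add: stiffness_def power2_eq_square)
  have "coord (real n *\<^sub>R (\<mu> *\<^sub>R sol - source) + F) i = 0" for i
  proof (cases i)
    case 0
    have "(\<Sum>k<d. if Suc k < d \<and> Suc k = i then c * q ^ k else 0) = 0"
      using 0 by simp
    then show ?thesis
      unfolding coord_add coordF using 0 pos n_pos
      by (simp add: coord_sol source_def c_def field_simps)
  next
    case (Suc j)
    show ?thesis
    proof (cases "i < d")
      case True
      have "(\<Sum>k<d. if Suc k < d \<and> Suc k = i then c * q ^ k else 0)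
          = (\<Sum>k<d. if k = j then c * q ^ k else 0)"
        by (rule sum.cong) (use True Suc in auto)
      then have "coord F i = c * q ^ i - c * q ^ j"
        unfolding coordF using True Suc by simp
      also have "\<dots> = - (stiffness * (1 - q) * (1 - q)) * amplitude * q ^ j"
        using Suc by (simp add: c_def algebra_simps)
      finally show ?thesis
        using True Suc by (simp add: s coord_sol source_def)
    next
      case False
      have "(\<Sum>k<d. if Suc k < d \<and> Suc k = i then c * q ^ k else 0) = 0"
        by (rule sum.neutral) (use False in auto)
      then show ?thesis
        using False Suc by (simp add: coordF coord_sol source_def)
    qed
  qed
  then have "real n *\<^sub>R (\<mu> *\<^sub>R sol - source) + F = 0"
    by (intro finseq_eqI) simp
  then show ?thesis
    unfolding quad_grad_def
    by (simp add: sum.distrib sum_subtractf sum_links[unfolded One_nat_def] F_def scaleR_diff_right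
        sum_constant_scaleR algebra_simps)
qed

text \<open>
  The objective is a quadratic with vanishing gradient at \<open>sol\<close>, and the springs only add to the
  excess \<open>\<mu> / 2 * (norm (x - sol))\<^sup>2\<close>.
\<close>

lemma objective_gap:
  "objective n instance_problem x \<ge> objective n instance_problem sol + \<mu> / 2 * (norm (x - sol))\<^sup>2"
proof -
  have "real n * (\<mu> / 2 * (norm (x - sol))\<^sup>2) + (\<Sum>i=1..n. summand i sol)
     = (\<Sum>i=1..n. summand i sol + \<mu> / 2 * (norm (x - sol))\<^sup>2)
        + inner (\<Sum>i=1..n. quad_grad \<mu> source link (links i) sol) (x - sol)"
    unfolding sol_stationary by (simp add: sum.distrib)
  also have "\<dots> = (\<Sum>i=1..n. summand i sol + inner (quad_grad \<mu> source link (links i) sol) (x - sol)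
        + \<mu> / 2 * (norm (x - sol))\<^sup>2)"
    by (simp add: sum.distrib inner_sum_left)
  also have "\<dots> \<le> (\<Sum>i=1..n. summand i x)"
  proof (rule sum_mono)
    fix i
    have "0 \<le> (\<Sum>k\<in>links i. (inner (link k) (x - sol))\<^sup>2)"
      by (rule sum_nonneg) simp
    then show "summand i sol + inner (quad_grad \<mu> source link (links i) sol) (x - sol)
        + \<mu> / 2 * (norm (x - sol))\<^sup>2 \<le> summand i x"
      using quad_expand[of \<mu> source link "links i" sol "x - sol"] by (simp add: summand_def)
  qed
  finally have "(real n * (\<mu> / 2 * (norm (x - sol))\<^sup>2) + (\<Sum>i=1..n. summand i sol)) / real n
     \<le> (\<Sum>i=1..n. summand i x) / real n"
    using n_pos by (intro divide_right_mono) auto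
  then show ?thesis
    using n_pos unfolding objective_eq by (simp add: add_divide_distrib)
qed

lemma objective_gap_Rn:
  assumes "x \<in> Rn m" "m < d"
  shows "objective n instance_problem x
    \<ge> objective n instance_problem sol + \<mu> / 2 * amplitude\<^sup>2 * q ^ (2 * m)"
proof -
  have "amplitude * q ^ m = \<bar>coord (x - sol) m\<bar>"
    using assms pos amplitude_pos by (simp add: Rn_def coord_sol)
  also have "\<dots> \<le> norm (x - sol)"
    by (rule abs_coord_le_norm)
  finally have "(amplitude * q ^ m)\<^sup>2 \<le> (norm (x - sol))\<^sup>2"
    using amplitude_pos pos by (intro power_mono) auto
  then have "\<mu> / 2 * (amplitude\<^sup>2 * q ^ (2 * m)) \<le> \<mu> / 2 * (norm (x - sol))\<^sup>2"
    using pos by (intro mult_left_mono) (auto simp: power_mult_distrib power_mult[symmetric] mult.commute)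
  then show ?thesis
    using objective_gap[of x] by (simp add: mult.assoc)
qed

lemma in_problem_class: "instance_problem \<in> problem_class n R L \<mu>"
proof -
  have conv: "convex (Rn d)"
    by (rule subspace_imp_convex[OF Rn_subspace])
  have "convex_on (Rn d) (\<lambda>x. (1 / real n) * (\<Sum>i=1..n. quad 0 source link (links i) x))"
    using n_pos conv owners by (intro convex_on_cmul convex_on_sum_fun convex_on_quad_0) simp
  also have "(\<lambda>x. (1 / real n) * (\<Sum>i=1..n. quad 0 source link (links i) x))
    = (\<lambda>x. objective n instance_problem x - \<mu> / 2 * (norm x)\<^sup>2)"
  proof
    fix x
    have "summand i x = \<mu> / 2 * (norm x)\<^sup>2 + quad 0 source link (links i) x" for i
      by (simp add: summand_def quad_def)
    then show "(1 / real n) * (\<Sum>i=1..n. quad 0 source link (links i) x)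
      = objective n instance_problem x - \<mu> / 2 * (norm x)\<^sup>2"
      using n_pos by (simp add: objective_eq sum.distrib add_divide_distrib)
  qed
  finally have "strongly_convex d \<mu> (objective n instance_problem)"
    by (simp add: strongly_convex_def)
  moreover have "diameter (Rn d \<inter> cball 0 R) \<le> 2 * R"
  proof (rule diameter_le)
    fix x y :: finseq assume "x \<in> Rn d \<inter> cball 0 R" "y \<in> Rn d \<inter> cball 0 R"
    then show "norm (x - y) \<le> 2 * R"
      using norm_triangle_ineq4[of x y] by simp
  qed (use pos in simp)
  moreover have "0 \<in> Rn d"
    by (simp add: Rn_def)
  ultimately show ?thesis
    using conv pos smooth_summand
    by (simp add: problem_class_def instance_problem_def closed_Rn closed_Int convex_Int bounded_Int)
qed

lemma INF_objective_le:
  "(INF x\<in>feasible instance_problem. objective n instance_problem x)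
     \<le> objective n instance_problem sol"
proof (rule cINF_lower)
  show "bdd_below (objective n instance_problem ` feasible instance_problem)"
    using objective_gap pos
    by (intro bdd_belowI2[of _ "objective n instance_problem sol"])
       (meson add_increasing2 mult_nonneg_nonneg zero_le_power2 less_imp_le half_gt_zero order_trans le_add_same_cancel1)
  show "sol \<in> feasible instance_problem"
    using sol_in_Rn norm_sol_le by (simp add: instance_problem_def)
qed

section \<open>Slow propagation along the chain\<close>

text \<open>
  After \<open>N\<close> openings only the coordinates up to \<open>2 * N\<close> can be nonzero: the spring that leads out
  of them is even, so it belongs to \<open>i0\<close>.
\<close>

definition reach :: "nat \<Rightarrow> finseq set" where
  "reach N = Rn (2 * N + 1) \<inter> Rn d"

lemma reach_mono: "N \<le> N' \<Longrightarrow> reach N \<subseteq> reach N'"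
  using Rn_mono[of "2 * N + 1" "2 * N' + 1"] by (auto simp: reach_def)

lemma reach_subspace: "subspace (reach N)"
  unfolding reach_def by (intro subspace_inter Rn_subspace)

text \<open>
  Erasing all coordinates from \<open>m\<close> on relaxes every spring beyond \<open>m\<close> and leaves those before \<open>m\<close>
  as they are; only a spring that crosses \<open>m\<close> could be stretched.
\<close>

lemma summand_trunc_le:
  assumes "0 < m" and uncut: "\<And>k. k \<in> links i \<Longrightarrow> Suc k \<noteq> m"
  shows "summand i (trunc m u) \<le> summand i u"
proof -
  have "(norm (trunc m u))\<^sup>2 \<le> (norm u)\<^sup>2"
    using norm_trunc_le by (intro power_mono) auto
  then have 1: "\<mu> / 2 * (norm (trunc m u))\<^sup>2 \<le> \<mu> / 2 * (norm u)\<^sup>2"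
    using pos by simp
  have 2: "(\<Sum>k\<in>links i. (inner (link k) (trunc m u))\<^sup>2) \<le> (\<Sum>k\<in>links i. (inner (link k) u)\<^sup>2)"
  proof (rule sum_mono)
    fix k assume "k \<in> links i"
    then have "Suc k \<noteq> m" by (rule uncut)
    then consider "Suc k < m" | "m \<le> k" by linarith
    then show "(inner (link k) (trunc m u))\<^sup>2 \<le> (inner (link k) u)\<^sup>2"
      by cases (simp_all add: inner_link)
  qed
  have 3: "inner source (trunc m u) = inner source u"
    using \<open>0 < m\<close> by (simp add: source_def)
  show ?thesis
    unfolding summand_def quad_def using 1 2 3 by simp
qed

lemma summand_trunc_le_reach:
  "summand i (trunc (if i = i0 then 2 * N + 2 else 2 * N + 1) u) \<le> summand i u"
  by (rule summand_trunc_le) (use owners in \<open>auto simp: links_def owner_def split: if_splits\<close>)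

lemma summand_grad_in_Rn: "x \<in> Rn d \<Longrightarrow> quad_grad \<mu> source link (links i) x \<in> Rn d"
  by (rule quad_grad_in_Rn) (auto simp: links_def link_in_Rn source_in_Rn)

lemma summand_grad_in_Rn_reach:
  assumes "x \<in> reach N"
  shows "quad_grad \<mu> source link (links i) x \<in> Rn (if i = i0 then 2 * N + 2 else 2 * N + 1)"
proof (rule grad_in_Rn_of_trunc_le[where d = d and g = "summand i"])
  show "(summand i has_derivative inner (quad_grad \<mu> source link (links i) x)) (at x within Rn d)"
    unfolding summand_def by (rule has_derivative_quad)
  show "quad_grad \<mu> source link (links i) x \<in> Rn d"
    using assms by (intro summand_grad_in_Rn) (simp add: reach_def)
  show "x \<in> Rn (if i = i0 then 2 * N + 2 else 2 * N + 1) \<inter> Rn d"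
    using assms Rn_mono[of "2 * N + 1" "2 * N + 2"] by (auto simp: reach_def)
qed (rule summand_trunc_le_reach)

lemma Rn_reach_succ:
  assumes "v \<in> Rn (if i = i0 then 2 * N + 2 else 2 * N + 1)" "v \<in> Rn d"
  shows "v \<in> reach (if i = i0 then Suc N else N)"
  using assms Rn_mono[of "2 * N + 2" "2 * Suc N + 1"] by (auto simp: reach_def split: if_splits)

lemma grad_summand_in_reach:
  assumes "x \<in> reach N"
  shows "grad d (summand i) x \<in> reach (if i = i0 then Suc N else N)"
proof -
  have x: "x \<in> Rn d"
    using assms by (simp add: reach_def)
  have "grad d (summand i) x = quad_grad \<mu> source link (links i) x"
    unfolding summand_def by (rule grad_eqI[OF has_derivative_quad summand_grad_in_Rn[OF x] x])
  then show ?thesis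
    using Rn_reach_succ[OF summand_grad_in_Rn_reach[OF assms] summand_grad_in_Rn[OF x]] by simp
qed

lemma prox_summand_in_reach:
  assumes "x \<in> reach N" "\<gamma> > 0"
  shows "prox d (summand i) \<gamma> x \<in> reach (if i = i0 then Suc N else N)"
proof (rule Rn_reach_succ)
  have "x \<in> Rn (if i = i0 then 2 * N + 2 else 2 * N + 1)"
    using assms Rn_mono[of "2 * N + 1" "2 * N + 2"] by (auto simp: reach_def)
  then have "prox d (summand i) \<gamma> x \<in> Rn (if i = i0 then 2 * N + 2 else 2 * N + 1) \<inter> Rn d"
    by (intro prox_in_Rn_of_trunc_le summand_trunc_le_reach assms)
  then show "prox d (summand i) \<gamma> x \<in> Rn (if i = i0 then 2 * N + 2 else 2 * N + 1)"
    "prox d (summand i) \<gamma> x \<in> Rn d" by blast+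
qed

text \<open>
  The full gradient also sees component \<open>i0\<close>, and so it may cross one even spring.  Even then it
  does not cross the odd one that follows.
\<close>

lemma grad_objective_in_reach:
  assumes "x \<in> reach N"
  shows "grad d (objective n instance_problem) x \<in> reach (Suc N)"
proof -
  have x: "x \<in> Rn d"
    using assms by (simp add: reach_def)
  define v where "v = (1 / real n) *\<^sub>R (\<Sum>i=1..n. quad_grad \<mu> source link (links i) x)"
  have "quad_grad \<mu> source link (links i) x \<in> reach (Suc N)" for i
    using Rn_reach_succ[OF summand_grad_in_Rn_reach[OF assms] summand_grad_in_Rn[OF x], of i]
      reach_mono[of N "Suc N"] by (auto split: if_splits)
  then have v: "v \<in> reach (Suc N)"
    unfolding v_def by (intro subspace_scale subspace_sum reach_subspace)
  have "((\<lambda>x. (1 / real n) * (\<Sum>i=1..n. summand i x)) has_derivative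
      (\<lambda>h. (1 / real n) * (\<Sum>i=1..n. inner (quad_grad \<mu> source link (links i) x) h))) (at x within Rn d)"
    unfolding summand_def by (intro has_derivative_mult_right has_derivative_sum has_derivative_quad)
  also have "(\<lambda>h. (1 / real n) * (\<Sum>i=1..n. inner (quad_grad \<mu> source link (links i) x) h)) = inner v"
    by (auto simp: v_def inner_sum_left)
  finally have "(objective n instance_problem has_derivative inner v) (at x within Rn d)"
    by (simp add: objective_eq[abs_def])
  then have "grad d (objective n instance_problem) x = v"
    using v x by (intro grad_eqI) (auto simp: reach_def)
  with v show ?thesis by simp
qed

text \<open>
  The steps that can cross an even spring: a query of \<open>i0\<close>, or a full gradient.
\<close>

definition opens :: "nat \<times> bool \<Rightarrow> bool" where
  "opens s \<longleftrightarrow> fst s = i0 \<or> snd s"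

text \<open>
  The bound on everything the algorithm knows is an invariant of the run.  The extra \<open>Suc\<close> pays
  for the full gradient at the starting point, which is known before the first step.
\<close>

lemma directions_in_reach:
  assumes A: "A \<in> pifo_algorithms c0 n"
  shows "tr_directions (foldl (pifo_step n A instance_problem) (initial_transcript n instance_problem) \<omega>)
      \<subseteq> reach (Suc (length (filter opens \<omega>)))
    \<and> tr_points (foldl (pifo_step n A instance_problem) (initial_transcript n instance_problem) \<omega>) \<noteq> []"
proof (induction \<omega> rule: rev_induct)
  case Nil
  have "0 \<in> reach 0" "0 \<in> reach (Suc 0)"
    by (auto simp: reach_def Rn_def)
  then show ?case
    using grad_objective_in_reach[of 0 0]
    by (simp add: initial_transcript_def tr_directions_def fo_oracle_def instance_problem_def)
next
  case (snoc s \<omega>)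
  obtain i a where s: "s = (i, a)" by (cases s)
  define tr where "tr = foldl (pifo_step n A instance_problem) (initial_transcript n instance_problem) \<omega>"
  define N where "N = Suc (length (filter opens \<omega>))"
  define N' where "N' = Suc (length (filter opens (\<omega> @ [s])))"
  have dirs: "tr_directions tr \<subseteq> reach N" and ne: "tr_points tr \<noteq> []"
    using snoc.IH by (auto simp: tr_def N_def)
  define \<gamma> where "\<gamma> = gamma_rule A tr i"
  define ob where "ob = \<lparr>obs_index = i, obs_gamma = \<gamma>,
      obs_pifo = map (pifo_oracle instance_problem i \<gamma>) (tr_points tr),
      obs_fo = (if a then Some (fo_oracle n instance_problem (last (tr_points tr))) else None)\<rparr>"
  define tr' where "tr' = tr\<lparr>tr_obs := tr_obs tr @ [ob]\<rparr>"
  define y where "y = proj (feasible instance_problem) (point_rule A tr')"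
  have step: "pifo_step n A instance_problem tr s = tr'\<lparr>tr_points := tr_points tr @ [y]\<rparr>"
    by (simp add: s pifo_step_def Let_def ob_def tr'_def y_def \<gamma>_def)
  have \<gamma>: "\<gamma> > 0" and span: "point_rule A tr' \<in> span (tr_directions tr')"
    using A by (simp_all add: pifo_algorithms_def \<gamma>_def)
  have NN': "N \<le> N'" "i = i0 \<Longrightarrow> Suc N \<le> N'" "a \<Longrightarrow> Suc N \<le> N'"
    by (auto simp: N_def N'_def s opens_def)
  have points: "x \<in> reach N" if "x \<in> set (tr_points tr)" for x
    using dirs that by (auto simp: tr_directions_def)
  have le: "(if i = i0 then Suc N else N) \<le> N'"
    using NN' by auto
  have pifo: "grad d (summand i) x \<in> reach N'" "prox d (summand i) \<gamma> x \<in> reach N'"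
    if "x \<in> set (tr_points tr)" for x
    using grad_summand_in_reach[OF points[OF that], of i] prox_summand_in_reach[OF points[OF that] \<gamma>, of i]
      reach_mono[OF le] by blast+
  have fo: "grad d (objective n instance_problem) (last (tr_points tr)) \<in> reach N'" if a
    using grad_objective_in_reach[OF points[OF last_in_set[OF ne]]] reach_mono[OF NN'(3)[OF that]] by blast
  have "tr_directions tr' \<subseteq> tr_directions tr
      \<union> {g. \<exists>v p. (v, g, p) \<in> set (obs_pifo ob)} \<union> {p. \<exists>v g. (v, g, p) \<in> set (obs_pifo ob)}
      \<union> {g. \<exists>v. obs_fo ob = Some (v, g)}"
    by (auto simp: tr_directions_def tr'_def)
  also have "\<dots> \<subseteq> reach N'"
    using dirs reach_mono[OF NN'(1)] pifo fo
    by (auto simp: ob_def pifo_oracle_def fo_oracle_def instance_problem_def[THEN arg_cong, of pdim]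
        instance_problem_def[THEN arg_cong, of component] split: if_splits)
  finally have dirs': "tr_directions tr' \<subseteq> reach N'" .
  then have "point_rule A tr' \<in> reach N'"
    using span span_minimal[OF dirs' reach_subspace] by blast
  then have y: "y \<in> reach N'"
    unfolding y_def using proj_ball_in_Rn[of "point_rule A tr'" "2 * N' + 1" d R] pos
    by (auto simp: reach_def instance_problem_def)
  have "tr_directions (tr'\<lparr>tr_points := tr_points tr @ [y]\<rparr>) \<subseteq> insert y (tr_directions tr')"
    by (auto simp: tr_directions_def tr'_def)
  then have "tr_directions (pifo_step n A instance_problem tr s) \<subseteq> reach N'"
    unfolding step using dirs' y by blast
  then show ?case
    by (simp add: tr_def[symmetric] N'_def step)
qed

lemma iterate_in_Rn:
  assumes "A \<in> pifo_algorithms c0 n"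
  shows "iterate n A instance_problem \<omega> \<in> Rn (2 * length (filter opens \<omega>) + 3)"
proof -
  have "iterate n A instance_problem \<omega> \<in> reach (Suc (length (filter opens \<omega>)))"
    using directions_in_reach[OF assms, of \<omega>] last_in_set
    unfolding iterate_def tr_directions_def by blast
  then show ?thesis
    by (simp add: reach_def numeral_3_eq_3)
qed

lemma prob_opens_le:
  assumes "pmf D i0 \<le> 1 / real n" "0 < b" "b \<le> 1" "b \<le> c0 / real n"
  shows "measure_pmf.prob (pair_pmf D (bernoulli_pmf b)) {s. opens s} \<le> (1 + c0) / real n"
proof -
  let ?M = "pair_pmf D (bernoulli_pmf b)"
  have "measure_pmf.prob ?M {s. opens s} = measure_pmf.prob ?M (fst -` {i0} \<union> snd -` {True})"
    by (rule arg_cong[where f = "measure_pmf.prob ?M"]) (auto simp: opens_def)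
  also have "\<dots> \<le> measure_pmf.prob ?M (fst -` {i0}) + measure_pmf.prob ?M (snd -` {True})"
    by (rule measure_subadditive) auto
  also have "\<dots> = measure_pmf.prob D {i0} + measure_pmf.prob (bernoulli_pmf b) {True}"
    unfolding measure_map_pmf[symmetric] map_fst_pair_pmf map_snd_pair_pmf ..
  also have "\<dots> \<le> (1 + c0) / real n"
    using assms by (simp add: measure_pmf_single add_divide_distrib)
  finally show ?thesis .
qed

text \<open>
  With \<open>N\<close> openings the gap is at least \<open>K * q ^ (4 * N)\<close>, and \<open>N\<close> has mean at most \<open>e\<close>.
  By convexity of the exponential the expected gap is at least \<open>K * q powr (4 * e)\<close>; the tangent
  at \<open>e\<close> makes this a statement about the mean of \<open>N\<close> only.
\<close>

lemma expected_gap: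
  assumes A: "A \<in> pifo_algorithms c0 n" and rare: "pmf (index_dist A) i0 \<le> 1 / real n"
    and T: "2 * T + 3 < d"
  shows "expected_value n A instance_problem T - (INF x\<in>feasible instance_problem. objective n instance_problem x)
    \<ge> \<mu> / 2 * amplitude\<^sup>2 * q ^ 6 * q powr (4 * real T * (1 + c0) / real n)"
proof -
  let ?p = "pair_pmf (index_dist A) (bernoulli_pmf (coin_prob A))"
  let ?M = "replicate_pmf T ?p"
  let ?obj = "objective n instance_problem"
  define K where "K = \<mu> / 2 * amplitude\<^sup>2 * q ^ 6"
  define e where "e = real T * (1 + c0) / real n"
  define count where "count \<omega> = real (length (filter opens \<omega>))" for \<omega>
  have K: "0 < K"
    using pos amplitude_pos by (simp add: K_def)
  have "set_pmf (index_dist A) \<subseteq> {1..n}"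
    using A by (simp add: pifo_algorithms_def)
  then have "finite (set_pmf (index_dist A))"
    by (rule finite_subset) simp
  then have fin: "finite (set_pmf ?p)"
    by (simp add: finite_subset[OF subset_UNIV])
  have finR: "finite (set_pmf ?M)"
    using fin by (rule finite_set_replicate_pmf)
  have int: "integrable (measure_pmf ?M) g" for g :: "_ \<Rightarrow> real"
    by (rule integrable_measure_pmf_finite[OF finR])
  have lnq: "ln q < 0"
    using pos by simp
  have tangent: "?obj sol + K * q powr (4 * e) * (1 - 4 * e * ln q) + K * q powr (4 * e) * 4 * ln q * count \<omega>
      \<le> ?obj (iterate n A instance_problem \<omega>)" if "\<omega> \<in> set_pmf ?M" for \<omega>
  proof -
    define N where "N = length (filter opens \<omega>)"
    have "length \<omega> = T"
      using that by (simp add: set_replicate_pmf)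
    then have "N \<le> T"
      using length_filter_le[of opens \<omega>] by (simp add: N_def)
    have "1 + 4 * (real N - e) * ln q \<le> exp (4 * (real N - e) * ln q)"
      by (rule exp_ge_add_one_self)
    then have "q powr (4 * e) * (1 + 4 * (real N - e) * ln q)
        \<le> q powr (4 * e) * exp (4 * (real N - e) * ln q)"
      by (rule mult_left_mono) simp
    also have "\<dots> = q powr real (4 * N)"
      using pos by (simp add: powr_def exp_add[symmetric] algebra_simps)
    also have "\<dots> = q ^ (4 * N)"
      using pos by (simp only: powr_realpow)
    finally have "K * (q powr (4 * e) * (1 + 4 * (real N - e) * ln q)) \<le> K * q ^ (4 * N)"
      using K by (intro mult_left_mono) auto
    also have "K * q ^ (4 * N) = \<mu> / 2 * amplitude\<^sup>2 * q ^ (2 * (2 * N + 3))"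
      by (simp add: K_def power_add[symmetric] mult.assoc add.commute)
    also have "\<dots> \<le> ?obj (iterate n A instance_problem \<omega>) - ?obj sol"
      using objective_gap_Rn[OF iterate_in_Rn[OF A], of \<omega>] T \<open>N \<le> T\<close> by (simp add: N_def)
    finally show ?thesis
      by (simp add: count_def N_def algebra_simps)
  qed
  have "measure_pmf.prob ?p {s. opens s} \<le> (1 + c0) / real n"
    using A by (intro prob_opens_le rare) (auto simp: pifo_algorithms_def)
  then have count_le: "measure_pmf.expectation ?M count \<le> e"
    unfolding count_def expectation_successes[OF fin] e_def
    using mult_left_mono[of _ "(1 + c0) / real n" "real T"] by simp
  have "?obj sol + K * q powr (4 * e) * (1 - 4 * e * ln q) + K * q powr (4 * e) * 4 * ln q * e
      \<le> ?obj sol + K * q powr (4 * e) * (1 - 4 * e * ln q)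
        + K * q powr (4 * e) * 4 * ln q * measure_pmf.expectation ?M count"
    using count_le K lnq by (intro add_left_mono mult_left_mono_neg) (auto simp: mult_nonneg_nonpos)
  also have "\<dots> = measure_pmf.expectation ?M
      (\<lambda>\<omega>. ?obj sol + K * q powr (4 * e) * (1 - 4 * e * ln q) + K * q powr (4 * e) * 4 * ln q * count \<omega>)"
    by (subst Bochner_Integration.integral_add[OF int int]) simp
  also have "\<dots> \<le> expected_value n A instance_problem T"
    unfolding expected_value_def using tangent by (intro integral_mono_AE int AE_pmfI)
  finally have "?obj sol + K * q powr (4 * e) \<le> expected_value n A instance_problem T"
    by (simp add: algebra_simps)
  then show ?thesis
    using INF_objective_le by (simp add: K_def e_def mult.assoc)
qed

end

section \<open>The lower bound for an arbitrary decay factor\<close>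

lemma ex_rare_index:
  assumes "set_pmf D \<subseteq> {1..n}" "0 < n"
  shows "\<exists>i\<in>{1..n}. pmf D i \<le> 1 / real n"
proof (rule ccontr)
  assume "\<not> ?thesis"
  then have "1 / real n < pmf D i" if "i \<in> {1..n}" for i
    using that by force
  then have "(\<Sum>i=1..n. 1 / real n) < (\<Sum>i=1..n. pmf D i)"
    using assms(2) by (intro sum_strict_mono) auto
  also have "\<dots> = 1"
    using assms(1) by (intro sum_pmf_eq_1) auto
  finally show False
    using assms(2) by simp
qed

text \<open>
  The instance depends on the algorithm: \<open>i0\<close> is an index that the algorithm samples with probability
  at most \<open>1 / n\<close>, and the chain is longer than the algorithm can advance within the claimed time.
\<close>

lemma minimax_complexity_ge:
  fixes n :: nat and c0 L \<mu> R q \<epsilon> :: real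
  assumes "0 < c0" "2 \<le> n" "0 < \<mu>" "0 < R" "0 < q" "q < 1" "0 < \<epsilon>"
    and smoothness: "2 * \<mu> \<le> L" "real n * \<mu> * q / (1 - q)\<^sup>2 \<le> L / 4"
  shows "ereal (real n / (4 * (1 + c0) * ln (1 / q)) * ln (\<mu> / 2 * (R * (1 - q))\<^sup>2 * q ^ 6 / \<epsilon>))
    \<le> ereal_of_enat (minimax_complexity c0 n \<epsilon> R L \<mu>)"
proof -
  define s0 where "s0 = \<mu> / 2 * (R * (1 - q))\<^sup>2 * q ^ 6"
  define B where "B = real n / (4 * (1 + c0) * ln (1 / q)) * ln (s0 / \<epsilon>)"
  define M where "M = nat \<lceil>B\<rceil>"
  have s0: "0 < s0"
    using assms by (simp add: s0_def)
  have "enat M \<le> minimax_complexity c0 n \<epsilon> R L \<mu>"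
    unfolding minimax_complexity_def
  proof (rule INF_greatest)
    fix A assume A: "A \<in> pifo_algorithms c0 n"
    then obtain i0 where i0: "i0 \<in> {1..n}" and rare: "pmf (index_dist A) i0 \<le> 1 / real n"
      using ex_rare_index[of "index_dist A" n] assms by (auto simp: pifo_algorithms_def)
    define j0 :: nat where "j0 = (if i0 = 1 then 2 else 1)"
    \<comment> \<open>At times \<open>T < M\<close> the iterate vanishes from index \<open>2 * T + 3\<close> on, which must be below the length.\<close>
    interpret hard_instance n L \<mu> R q "2 * M + 4" i0 j0
      using assms i0 by unfold_locales (auto simp: j0_def)
    have "enat M \<le> hitting_time n A instance_problem \<epsilon>"
      unfolding hitting_time_def
    proof (rule Inf_greatest)
      fix z assume "z \<in> {enat T |T. expected_value n A instance_problem T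
        - (INF x\<in>feasible instance_problem. objective n instance_problem x) < \<epsilon>}"
      then obtain T where z: "z = enat T" and hit: "expected_value n A instance_problem T
        - (INF x\<in>feasible instance_problem. objective n instance_problem x) < \<epsilon>"
        by blast
      have "\<not> T < M"
      proof
        assume "T < M"
        then have "real T < B"
          unfolding M_def by linarith
        then have "4 * real T * (1 + c0) / real n * ln (1 / q) \<le> ln (s0 / \<epsilon>)"
        proof -
          have "0 < 4 * (1 + c0) * ln (1 / q)"
            using assms by (intro mult_pos_pos ln_gt_zero) auto
          moreover have "real T < real n * ln (s0 / \<epsilon>) / (4 * (1 + c0) * ln (1 / q))"
            using \<open>real T < B\<close> by (simp add: B_def)
          ultimately have "real T * (4 * (1 + c0) * ln (1 / q)) < real n * ln (s0 / \<epsilon>)"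
            by (subst (asm) pos_less_divide_eq)
          then have "real T * (4 * (1 + c0) * ln (1 / q)) / real n \<le> ln (s0 / \<epsilon>)"
            using assms by (subst pos_divide_le_eq) (auto simp: mult.commute)
          then show ?thesis
            by (simp add: mult_ac)
        qed
        then have "- ln (s0 / \<epsilon>) \<le> 4 * real T * (1 + c0) / real n * ln q"
          using assms by (simp add: ln_div)
        then have "exp (- ln (s0 / \<epsilon>)) \<le> q powr (4 * real T * (1 + c0) / real n)"
          using assms by (simp add: powr_def)
        then have "s0 * exp (- ln (s0 / \<epsilon>)) \<le> s0 * q powr (4 * real T * (1 + c0) / real n)"
          using s0 by simp
        moreover have "s0 * exp (- ln (s0 / \<epsilon>)) = \<epsilon>"
          using s0 assms by (simp add: exp_minus)
        moreover have "s0 = \<mu> / 2 * amplitude\<^sup>2 * q ^ 6"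
          by (simp add: s0_def amplitude_def)
        ultimately show False
          using expected_gap[OF A rare, of T] hit \<open>T < M\<close> by simp
      qed
      with z show "enat M \<le> z" by simp
    qed
    also have "\<dots> \<le> (SUP P\<in>problem_class n R L \<mu>. hitting_time n A P \<epsilon>)"
      by (rule SUP_upper[OF in_problem_class])
    finally show "enat M \<le> (SUP P\<in>problem_class n R L \<mu>. hitting_time n A P \<epsilon>)" .
  qed
  then have "ereal_of_enat (enat M) \<le> ereal_of_enat (minimax_complexity c0 n \<epsilon> R L \<mu>)"
    by (simp only: ereal_of_enat_le_iff)
  moreover have "ereal B \<le> ereal_of_enat (enat M)"
    by (simp add: M_def real_nat_ceiling_ge)
  ultimately show ?thesis
    unfolding B_def s0_def by (rule order_trans[rotated])
qed

section \<open>The choice of the decay factor\<close>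

text \<open>
  The decay factor of the chain will be \<open>1 / (1 + t)\<close> with \<open>u = n / \<kappa>\<close>.  The admissible stiffness
  requires the first inequality.  The summand \<open>sqrt (8 * u)\<close> of \<open>t\<close> serves \<open>1 / t\<^sup>2\<close> and
  dominates for ill-conditioned problems; \<open>8 * u\<close> serves \<open>1 / t\<close> and dominates for
  well-conditioned ones.
\<close>

lemma decay_rate:
  fixes u :: real
  assumes "0 < u"
  defines "t \<equiv> sqrt (8 * u) + 8 * u"
  shows "(1 + t) / t\<^sup>2 \<le> 1 / (4 * u)" "ln (1 + t) \<le> 6 * sqrt u"
    "ln (1 + t) \<le> 3 * (1 + max 0 (ln u))"
proof -
  have t: "0 < t" "8 * u \<le> t"
    using assms by (simp_all add: add_pos_pos)
  have "(sqrt (8 * u))\<^sup>2 \<le> t\<^sup>2"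
    using assms by (intro power_mono) auto
  then have "8 * u \<le> t\<^sup>2"
    using assms by simp
  then have "1 / t\<^sup>2 \<le> 1 / (8 * u)"
    using assms(1) by (intro frac_le) auto
  moreover have "1 / t \<le> 1 / (8 * u)"
    using assms(1) t(2) by (intro frac_le) auto
  moreover have "(1 + t) / t\<^sup>2 = 1 / t\<^sup>2 + 1 / t"
    using t by (simp add: field_simps power2_eq_square)
  ultimately show "(1 + t) / t\<^sup>2 \<le> 1 / (4 * u)"
    by simp
  have sqrt8: "sqrt (8 * u) \<le> 3 * sqrt u"
    using assms by (intro real_le_lsqrt) (auto simp: power_mult_distrib)
  have "1 + t \<le> (1 + sqrt (8 * u))\<^sup>2"
    using assms by (simp add: t_def power2_sum)
  then have "ln (1 + t) \<le> ln ((1 + sqrt (8 * u))\<^sup>2)"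
    using t(1) by (subst ln_le_cancel_iff) linarith+
  also have "\<dots> = 2 * ln (1 + sqrt (8 * u))"
    using assms by (simp add: ln_realpow add_pos_pos)
  also have "\<dots> \<le> 2 * sqrt (8 * u)"
    using assms by (simp add: ln_add_one_self_le_self)
  finally show "ln (1 + t) \<le> 6 * sqrt u"
    using sqrt8 by simp
  \<comment> \<open>\<open>1 + t\<close> is at most \<open>1 + 3 * sqrt u + 8 * u\<close>, and each of \<open>1\<close>, \<open>sqrt u\<close>, \<open>u\<close> is at most \<open>w\<close>.\<close>
  define w where "w = max 1 u"
  have w: "1 \<le> w" "u \<le> w"
    by (auto simp: w_def)
  have "sqrt u \<le> w"
    using w assms by (intro real_le_lsqrt) (auto simp: power2_eq_square intro: order_trans[OF _ mult_right_mono[of 1 w w]])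
  then have "1 + t \<le> 12 * w"
    using w sqrt8 by (simp add: t_def)
  then have "ln (1 + t) \<le> ln (12 * w)"
    using t(1) by (subst ln_le_cancel_iff) linarith+
  also have "\<dots> = ln 12 + ln w"
    using w by (simp add: ln_mult)
  also have "ln w = max 0 (ln u)"
    using assms by (auto simp: w_def max_def)
  also have "ln (12::real) \<le> 3"
  proof -
    have "(5 / 2 :: real) \<le> exp 1"
      using exp_lower_Taylor_quadratic[of 1] by simp
    then have "(5 / 2 :: real) ^ 3 \<le> exp 1 ^ 3"
      by (intro power_mono) auto
    also have "\<dots> = exp 3"
      by (simp add: exp_of_nat_mult[symmetric])
    finally have "12 \<le> exp (3::real)"
      by (simp add: power3_eq_cube)
    then have "ln 12 \<le> ln (exp (3::real))"
      by (subst ln_le_cancel_iff) auto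
    then show ?thesis by simp
  qed
  finally show "ln (1 + t) \<le> 3 * (1 + max 0 (ln u))"
    by (simp add: max_def split: if_splits)
qed

theorem theoremE6:
  fixes c0 c' :: real
  assumes "c0 > 0" and "c' > 0"
  shows "\<exists>c>0. \<forall>(n::nat) (L::real) (\<mu>::real) (R::real).
    n \<ge> 2 \<longrightarrow> L > 0 \<longrightarrow> \<mu> > 0 \<longrightarrow> R > 0 \<longrightarrow> L / \<mu> \<ge> 2 \<longrightarrow>
    (\<exists>s>0. \<forall>\<epsilon>>0. \<epsilon> \<le> L * R\<^sup>2 / 4 \<longrightarrow>
      (let \<kappa> = L / \<mu> in
        (\<kappa> \<ge> c' * real n \<longrightarrow>
          ereal (c * ((real n + sqrt (\<kappa> * real n)) * ln (s / \<epsilon>)))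
            \<le> ereal_of_enat (minimax_complexity c0 n \<epsilon> R L \<mu>)) \<and>
        (\<kappa> \<le> c' * real n \<longrightarrow>
          ereal (c * (real n + real n / (1 + max 0 (ln (real n / \<kappa>))) * ln (s / \<epsilon>)))
            \<le> ereal_of_enat (minimax_complexity c0 n \<epsilon> R L \<mu>))))"
proof -
  define c where "c = 1 / (24 * (1 + c0) * (1 + 1 / sqrt c'))"
  have c: "0 < c"
    using assms by (simp add: c_def add_pos_pos)
  have c_le: "c \<le> 1 / (12 * (1 + c0))"
  proof -
    have "12 * (1 + c0) * 1 \<le> 24 * (1 + c0) * (1 + 1 / sqrt c')"
      using assms by (intro mult_mono) auto
    then show ?thesis
      unfolding c_def using assms by (intro frac_le) auto
  qed
  have "\<exists>s>0. \<forall>\<epsilon>>0. \<epsilon> \<le> L * R\<^sup>2 / 4 \<longrightarrow>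
      (let \<kappa> = L / \<mu> in
        (\<kappa> \<ge> c' * real n \<longrightarrow>
          ereal (c * ((real n + sqrt (\<kappa> * real n)) * ln (s / \<epsilon>)))
            \<le> ereal_of_enat (minimax_complexity c0 n \<epsilon> R L \<mu>)) \<and>
        (\<kappa> \<le> c' * real n \<longrightarrow>
          ereal (c * (real n + real n / (1 + max 0 (ln (real n / \<kappa>))) * ln (s / \<epsilon>)))
            \<le> ereal_of_enat (minimax_complexity c0 n \<epsilon> R L \<mu>)))"
    if n: "n \<ge> 2" and pos: "L > 0" "\<mu> > 0" "R > 0" and "L / \<mu> \<ge> 2" for n :: nat and L \<mu> R :: real
  proof -
    define \<kappa> where "\<kappa> = L / \<mu>"
    define u where "u = real n / \<kappa>"
    define t where "t = sqrt (8 * u) + 8 * u"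
    define l where "l = max 0 (ln u)"
    define q where "q = 1 / (1 + t)"
    define s0 where "s0 = \<mu> / 2 * (R * (1 - q))\<^sup>2 * q ^ 6"
    \<comment> \<open>The factor makes \<open>ln (s / \<epsilon>)\<close> smaller by \<open>1 + l\<close>, which absorbs the additive
        term \<open>n\<close> of the well-conditioned case.\<close>
    define s where "s = s0 * exp (- (1 + l))"
    have \<kappa>: "0 < \<kappa>"
      using pos by (simp add: \<kappa>_def)
    have u: "0 < u"
      using \<kappa> n by (simp add: u_def)
    have t: "0 < t"
      using u by (simp add: t_def add_pos_pos)
    have q: "0 < q" "q < 1"
      using t by (simp_all add: q_def)
    have l: "0 \<le> l"
      by (simp add: l_def)
    have s0: "0 < s0"
      using q pos by (simp add: s0_def)
    have s: "0 < s"
      using s0 by (simp add: s_def)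
    have "1 - q = t / (1 + t)"
      using t by (simp add: q_def field_simps)
    then have "q / (1 - q)\<^sup>2 = (1 + t) / t\<^sup>2"
      using t by (simp add: q_def power_divide power2_eq_square)
    then have "real n * \<mu> * (q / (1 - q)\<^sup>2) \<le> real n * \<mu> * (1 / (4 * u))"
      using decay_rate(1)[OF u] pos n unfolding t_def by (intro mult_left_mono) auto
    also have "\<dots> = L / 4"
      using pos n by (simp add: u_def \<kappa>_def)
    finally have stiff: "real n * \<mu> * q / (1 - q)\<^sup>2 \<le> L / 4"
      by simp
    have "2 * \<mu> \<le> L"
      using that by (simp add: field_simps)
    define D where "D = ln (1 + t)"
    have D: "0 < D" "D \<le> 6 * sqrt u" "D \<le> 3 * (1 + l)"
      using decay_rate(2,3)[OF u] t unfolding D_def t_def l_def by simp_all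
    have main: "ereal (real n / (4 * (1 + c0) * D) * ln (s0 / \<epsilon>))
        \<le> ereal_of_enat (minimax_complexity c0 n \<epsilon> R L \<mu>)" if "\<epsilon> > 0" for \<epsilon>
      using minimax_complexity_ge[OF assms(1) n pos(2,3) q that \<open>2 * \<mu> \<le> L\<close> stiff]
      by (simp add: D_def q_def s0_def)
    have rate1: "c * (real n + sqrt (\<kappa> * real n)) \<le> real n / (4 * (1 + c0) * D)"
      if "\<kappa> \<ge> c' * real n"
    proof -
      define r where "r = sqrt (\<kappa> * real n)"
      have "sqrt c' * real n = sqrt (c' * real n * real n)"
        by (simp add: real_sqrt_mult)
      also have "\<dots> \<le> r"
        unfolding r_def using that by (intro real_sqrt_le_mono mult_right_mono) auto
      finally have "real n + r \<le> (1 + 1 / sqrt c') * r"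
        using assms by (simp add: field_simps)
      then have "c * (real n + r) \<le> c * ((1 + 1 / sqrt c') * r)"
        using c by (intro mult_left_mono) auto
      also have "\<dots> = r / (24 * (1 + c0))"
      proof -
        have "1 + 1 / sqrt c' \<noteq> 0"
          using assms by (smt (verit) divide_pos_pos real_sqrt_gt_zero)
        then show ?thesis by (simp add: c_def)
      qed
      also have "\<dots> \<le> real n / (4 * (1 + c0) * D)"
      proof -
        have "sqrt u * r = sqrt (real n * real n)"
          using \<kappa> unfolding r_def u_def by (simp add: real_sqrt_mult[symmetric])
        then have "sqrt u * r = real n" by simp
        moreover have "r * D \<le> r * (6 * sqrt u)"
          using D \<kappa> by (intro mult_left_mono) (auto simp: r_def)
        ultimately have "r * D \<le> 6 * real n"
          by (simp add: mult.commute)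
        then have "r \<le> 6 * real n / D"
          using D(1) by (subst pos_le_divide_eq)
        then have "r / (24 * (1 + c0)) \<le> 6 * real n / D / (24 * (1 + c0))"
          using assms by (intro divide_right_mono) auto
        also have "6 * real n / D / (24 * (1 + c0)) = real n / (4 * (1 + c0) * D)"
          using D(1) assms by (simp add: divide_simps)
        finally show ?thesis .
      qed
      finally show ?thesis by (simp add: r_def)
    qed
    have rate2: "c * (real n / (1 + l)) \<le> real n / (4 * (1 + c0) * D)"
    proof -
      have "c * (real n / (1 + l)) \<le> 1 / (12 * (1 + c0)) * (real n / (1 + l))"
        using c_le l by (intro mult_right_mono) auto
      also have "\<dots> = real n / (4 * (1 + c0) * (3 * (1 + l)))"
        by (simp add: algebra_simps)
      also have "\<dots> \<le> real n / (4 * (1 + c0) * D)"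
        using D l assms by (intro divide_left_mono mult_left_mono mult_pos_pos) auto
      finally show ?thesis .
    qed
    have nonneg: "ereal x \<le> ereal_of_enat N" if "x \<le> 0" for x N
    proof -
      have "ereal x \<le> 0" using that by simp
      also have "0 \<le> ereal_of_enat N" by simp
      finally show ?thesis .
    qed
    have bound: "ereal (k * X) \<le> ereal_of_enat (minimax_complexity c0 n \<epsilon> R L \<mu>)"
      if "0 \<le> k" "k \<le> real n / (4 * (1 + c0) * D)" "X \<le> ln (s0 / \<epsilon>)" "\<epsilon> > 0" for k X \<epsilon>
    proof (cases "X \<le> 0")
      case True
      then show ?thesis
        using \<open>0 \<le> k\<close> by (intro nonneg) (simp add: mult_nonneg_nonpos)
    next
      case False
      then have "k * X \<le> real n / (4 * (1 + c0) * D) * ln (s0 / \<epsilon>)"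
        using that by (intro mult_mono) auto
      then have "ereal (k * X) \<le> ereal (real n / (4 * (1 + c0) * D) * ln (s0 / \<epsilon>))"
        by simp
      also note main[OF \<open>\<epsilon> > 0\<close>]
      finally show ?thesis .
    qed
    have ln_s: "ln (s / \<epsilon>) = ln (s0 / \<epsilon>) - (1 + l)" if "\<epsilon> > 0" for \<epsilon>
      using that s0 by (simp add: s_def ln_div ln_mult)
    have "ereal (c * ((real n + sqrt (\<kappa> * real n)) * ln (s / \<epsilon>)))
        \<le> ereal_of_enat (minimax_complexity c0 n \<epsilon> R L \<mu>)"
      if "\<epsilon> > 0" "\<kappa> \<ge> c' * real n" for \<epsilon>
      using bound[OF _ rate1[OF that(2)], of "ln (s / \<epsilon>)" \<epsilon>] that c \<kappa> l
      by (simp add: ln_s mult.assoc)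
    moreover have "ereal (c * (real n + real n / (1 + l) * ln (s / \<epsilon>)))
        \<le> ereal_of_enat (minimax_complexity c0 n \<epsilon> R L \<mu>)"
      if "\<epsilon> > 0" for \<epsilon>
    proof -
      have "c * (real n + real n / (1 + l) * ln (s / \<epsilon>)) = c * (real n / (1 + l)) * ln (s0 / \<epsilon>)"
        using l by (simp add: ln_s[OF that] field_simps)
      then show ?thesis
        using bound[OF _ rate2 order_refl that] c l by simp
    qed
    ultimately show ?thesis
      using s unfolding Let_def \<kappa>_def[symmetric] u_def[symmetric] l_def[symmetric]
      by (intro exI[of _ s]) auto
  qed
  with c show ?thesis by blast
qed

end
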